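(* For each integer $n\geq 1$ we have $$1+\Pi_n=\lim_{d\to+\infty}\Pi(d-n,d).$$
   Context: For a finite-dimensional real Banach space $E$, fix a linear isometric embedding $E\subset \ell_\infty(\mathbb{N})$; the linear projection constant of $E$ is $\Pi(E):=\inf\{\|P\| : P\colon \ell_\infty(\mathbb{N})\to E \text{ bounded surjective linear map with } P^2=P\}$ (independent of the embedding). Set $\Pi_n:=\max\{\Pi(X) : X \text{ an } n\text{-dimensional real Banach space}\}$ (this maximum exists). For integers $0\le m\leq d$ set $\Pi(m,d):=\sup\{\Pi(E) : E\subset \ell_\infty^d \text{ is an } m\text{-dimensional linear subspace}\}$, where $\ell_\infty^d$ is $\mathbb{R}^d$ with the maximum norm and $E$ carries the induced norm. *)

theory Defs
  imports "HOL-Analysis.Analysis"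
begin

text \<open>Every function on the discrete space \<open>nat\<close> is continuous, so the bounded continuous
  functions with their library norm are exactly the bounded real sequences with the supremum norm.\<close>

type_synonym linf = "nat \<Rightarrow>\<^sub>C real"

text \<open>A finite-dimensional real Banach space is given by a linear subspace \<open>V\<close> of some ambient real
  vector space, together with a norm \<open>N\<close> on \<open>V\<close> that need not be related to any norm of the ambient
  space. Values of \<open>N\<close> outside \<open>V\<close> are irrelevant. Completeness is automatic.\<close>

definition norm_on :: "'a::real_vector set \<Rightarrow> ('a \<Rightarrow> real) \<Rightarrow> bool" where
  "norm_on V N \<longleftrightarrow>
     (\<forall>x\<in>V. 0 \<le> N x \<and> (N x = 0 \<longleftrightarrow> x = 0)) \<and>
     (\<forall>x\<in>V. \<forall>c. N (c *\<^sub>R x) = \<bar>c\<bar> * N x) \<and>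
     (\<forall>x\<in>V. \<forall>y\<in>V. N (x + y) \<le> N x + N y)"

definition isometric_embedding :: "'a::real_vector set \<Rightarrow> ('a \<Rightarrow> real) \<Rightarrow> ('a \<Rightarrow> linf) \<Rightarrow> bool" where
  "isometric_embedding V N j \<longleftrightarrow>
     (\<forall>x\<in>V. \<forall>y\<in>V. j (x + y) = j x + j y) \<and>
     (\<forall>x\<in>V. \<forall>c. j (c *\<^sub>R x) = c *\<^sub>R j x) \<and>
     (\<forall>x\<in>V. norm (j x) = N x)"

definition projection_onto :: "linf set \<Rightarrow> (linf \<Rightarrow> linf) \<Rightarrow> bool" where
  "projection_onto F P \<longleftrightarrow> bounded_linear P \<and> range P = F \<and> P \<circ> P = P"

text \<open>The choice operator fixes one linear isometric embedding of \<open>(V, N)\<close>; the value does not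
  depend on which one.\<close>

definition proj_const :: "'a::real_vector set \<Rightarrow> ('a \<Rightarrow> real) \<Rightarrow> real" where
  "proj_const V N =
     (let j = (SOME j. isometric_embedding V N j)
      in Inf {onorm P | P. projection_onto (j ` V) P})"

text \<open>The sequences vanishing from index \<open>d\<close> on serve as \<open>\<real>\<^sup>d\<close>; the norm inherited
  from \<^typ>\<open>linf\<close> is the maximum norm, see \<open>norm_coord_space\<close> and \<open>dim_coord_space\<close>.\<close>

definition coord_space :: "nat \<Rightarrow> linf set" where
  "coord_space d = {x. \<forall>i\<ge>d. apply_bcontfun x i = 0}"

text \<open>Here \<open>coord_space n\<close> is used only as an \<open>n\<close>-dimensional vector space: up to linear isometry,
  every \<open>n\<close>-dimensional real Banach space is \<open>\<real>\<^sup>n\<close> with some norm \<open>N\<close>. The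
  maximum exists by compactness of the Banach--Mazur compactum.\<close>

definition max_proj_const :: "nat \<Rightarrow> real" where
  "max_proj_const n = (GREATEST r. \<exists>N. norm_on (coord_space n) N \<and> r = proj_const (coord_space n) N)"

definition sup_proj_const :: "nat \<Rightarrow> nat \<Rightarrow> real" where
  "sup_proj_const m d = Sup {proj_const E norm | E. subspace E \<and> E \<subseteq> coord_space d \<and> dim E = m}"

lemma norm_coord_space:
  assumes "x \<in> coord_space d" "d > 0"
  shows "norm x = Max ((\<lambda>i. \<bar>apply_bcontfun x i\<bar>) ` {..<d})"
proof (rule antisym)
  let ?M = "Max ((\<lambda>i. \<bar>apply_bcontfun x i\<bar>) ` {..<d})"
  have le: "\<bar>apply_bcontfun x i\<bar> \<le> ?M" if "i < d" for i
    using that by (intro Max_ge) auto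
  have "\<bar>apply_bcontfun x i\<bar> \<le> ?M" for i
  proof (cases "i < d")
    case False
    then have "apply_bcontfun x i = 0" using assms(1) by (simp add: coord_space_def)
    then show ?thesis using le[OF assms(2)] by simp
  qed (rule le)
  then show "norm x \<le> ?M" by (intro norm_bound) simp
next
  show "Max ((\<lambda>i. \<bar>apply_bcontfun x i\<bar>) ` {..<d}) \<le> norm x"
    using assms(2) by (subst Max_le_iff) (auto simp: norm_bounded simp flip: real_norm_def)
qed

lemma dim_coord_space: "dim (coord_space d) = d"
proof -
  define e :: "nat \<Rightarrow> linf" where "e k = Bcontfun (\<lambda>i. if i = k then 1 else 0)" for k
  have e: "apply_bcontfun (e k) i = (if i = k then 1 else 0)" for k i
    unfolding e_def
    by (subst Bcontfun_inverse)
      (auto simp: bcontfun_def intro!: finite_imp_bounded finite_subset[of _ "{0,1::real}"])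
  have ap_sum: "apply_bcontfun (\<Sum>k\<in>A. f k) i = (\<Sum>k\<in>A. apply_bcontfun (f k) i)"
    for f :: "'b \<Rightarrow> linf" and A i
    by (induction A rule: infinite_finite_induct) auto
  have inj: "inj_on e {..<d}"
    by (rule inj_onI) (metis e zero_neq_one)
  have indep: "independent (e ` {..<d})"
  proof (rule independent_if_scalars_zero)
    fix f x assume s: "(\<Sum>v\<in>e ` {..<d}. f v *\<^sub>R v) = 0" and "x \<in> e ` {..<d}"
    then obtain k where k: "k < d" "x = e k" by auto
    have "0 = apply_bcontfun (\<Sum>l<d. f (e l) *\<^sub>R e l) k"
      using s by (simp add: sum.reindex[OF inj])
    also have "\<dots> = f x" using k by (simp add: ap_sum e if_distrib cong: if_cong)
    finally show "f x = 0" by simp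
  qed auto
  have "x \<in> span (e ` {..<d})" if "x \<in> coord_space d" for x
  proof -
    have "x = (\<Sum>k<d. apply_bcontfun x k *\<^sub>R e k)"
      using that by (intro bcontfun_eqI) (simp add: ap_sum e if_distrib coord_space_def cong: if_cong)
    moreover have "\<dots> \<in> span (e ` {..<d})"
      by (intro span_sum span_scale span_base) auto
    ultimately show ?thesis by simp
  qed
  then have "coord_space d \<subseteq> span (e ` {..<d})" by blast
  moreover have "e ` {..<d} \<subseteq> coord_space d" by (auto simp: coord_space_def e)
  moreover have "card (e ` {..<d}) = d" by (simp add: card_image[OF inj])
  ultimately show ?thesis using indep by (metis dim_unique)
qed

end

theory Submission
  imports Defs
begin

text \<open>
  The upper and the lower bound both rest on transposing matrices. If \<open>P\<close> projects \<open>\<ell>\<^sub>\<infinity>\<^sup>d\<close> onto a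
  subspace \<open>E\<close> of codimension \<open>n\<close>, then \<open>I - P\<close> is a projection with kernel \<open>E\<close>, and its transpose
  projects \<open>\<ell>\<^sub>1\<^sup>d\<close> onto the \<open>n\<close>-dimensional annihilator of \<open>E\<close>. So projections onto large subspaces
  are controlled by projections onto \<open>n\<close>-dimensional spaces.

  Upper bound (\<open>small_projection_codim\<close>). By the Hahn--Banach theorem for each coordinate, operators
  into the bounded sequences extend without increase of norm (\<open>linf_injective\<close>). Therefore an
  \<open>n\<close>-dimensional subspace of any normed space, such as the annihilator of \<open>E\<close> in \<open>\<ell>\<^sub>1\<^sup>d\<close>, is the
  range of a projection whose norm exceeds the maximal projection constant by as little as desired.
  The identity minus its transpose projects onto \<open>E\<close> and has a norm larger by at most \<open>1\<close>.

  Lower bound (\<open>large_projections_codim\<close>). Let \<open>X\<close> be an \<open>n\<close>-dimensional space with the largest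
  projection constant. It exists because suitably normalised norms form a compact set on which the
  projection constant is continuous (\<open>max_proj_const_attained\<close>). Finitely many coordinates \<open>f\<^sub>i\<close> of an
  embedding of \<open>X\<close> determine its norm up to a small error, and projections become families \<open>v\<close> of
  vectors with \<open>(\<Sum>i. f\<^sub>i(u) v\<^sub>i) = u\<close>, measured by the largest absolute row sum of the matrix
  \<open>f\<^sub>i(v\<^sub>k)\<close>. A minimax theorem replaces the largest row sum by a weighted average that
  is large for all these families at once (\<open>minimax_weights\<close>). Repeating every index in proportion
  to its weight makes the weights equal; the average row sum is then the sum of all absolute entries
  divided by the number of rows. This does not change under transposition, so it is also large for
  \<open>I - P\<close>, whenever \<open>P\<close> projects onto the annihilator \<open>E\<close> of the repeated functionals. Finally, columns of \<open>I - P\<close> that belong to copies of the same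
  index coincide. Hence the diagonal entries are small compared to the row sums, the identity
  hardly cancels against them, and the norm of \<open>P\<close> is almost \<open>1\<close> larger than
  the average row sum of \<open>I - P\<close>.
\<close>

section \<open>Sublinear functionals and the Hahn--Banach theorem\<close>

definition sublinear :: "('a::real_vector \<Rightarrow> real) \<Rightarrow> bool" where
  "sublinear p \<longleftrightarrow> (\<forall>x y. p (x + y) \<le> p x + p y) \<and> (\<forall>c x. 0 \<le> c \<longrightarrow> p (c *\<^sub>R x) = c * p x)"

lemma sublinear_add: "sublinear p \<Longrightarrow> p (x + y) \<le> p x + p y"
  and sublinear_scale: "sublinear p \<Longrightarrow> 0 \<le> c \<Longrightarrow> p (c *\<^sub>R x) = c * p x"
  by (auto simp: sublinear_def)

lemma sublinear_zero: "sublinear p \<Longrightarrow> p 0 = 0"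
  using sublinear_scale[of p 0 0] by simp

text \<open>The lower envelope of a convex cone is sublinear. It is finite because a point \<open>(x, r)\<close> and
  a point \<open>(- x, s)\<close> of the cone add up to \<open>(0, r + s)\<close>, which forces \<open>r \<ge> - s\<close>. Chains of
  functionals, functionals on subspaces and families of convex functions all lead to such cones
  below, on which the conditions are checked without handling infima.\<close>

lemma cone_lower_envelope:
  fixes K :: "('a::real_vector \<times> real) set"
  assumes add: "\<And>x r y s. (x, r) \<in> K \<Longrightarrow> (y, s) \<in> K \<Longrightarrow> (x + y, r + s) \<in> K"
    and scale: "\<And>c x r. 0 < c \<Longrightarrow> (x, r) \<in> K \<Longrightarrow> (c *\<^sub>R x, c * r) \<in> K"
    and zero: "(0, 0) \<in> K" and proper: "\<And>r. (0, r) \<in> K \<Longrightarrow> 0 \<le> r"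
    and total: "\<And>x. \<exists>r. (x, r) \<in> K"
  obtains q where "sublinear q" "\<And>x r. (x, r) \<in> K \<Longrightarrow> q x \<le> r"
proof
  let ?q = "\<lambda>x. Inf {r. (x, r) \<in> K}"
  have bdd: "bdd_below {r. (x, r) \<in> K}" for x
  proof -
    obtain s where s: "(- x, s) \<in> K" using total by blast
    have "- s \<le> r" if "(x, r) \<in> K" for r
      using proper[of "r + s"] add[OF that s] by simp
    then show ?thesis by (auto simp: bdd_below_def)
  qed
  show le: "?q x \<le> r" if "(x, r) \<in> K" for x r
    using that bdd by (auto intro: cInf_lower)
  have ge: "b \<le> ?q x" if "\<And>r. (x, r) \<in> K \<Longrightarrow> b \<le> r" for x b
    using that total[of x] by (auto intro: cInf_greatest)
  have sub: "?q (x + y) \<le> ?q x + ?q y" for x y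
  proof -
    have "?q (x + y) - ?q y \<le> ?q x"
    proof (rule ge)
      fix r assume r: "(x, r) \<in> K"
      have "?q (x + y) - r \<le> ?q y"
      proof (rule ge)
        fix s assume "(y, s) \<in> K"
        then have "?q (x + y) \<le> r + s" using le add r by blast
        then show "?q (x + y) - r \<le> s" by linarith
      qed
      then show "?q (x + y) - ?q y \<le> r" by linarith
    qed
    then show ?thesis by linarith
  qed
  have hom_le: "c * ?q x \<le> ?q (c *\<^sub>R x)" if "0 < c" for c x
  proof (rule ge)
    fix r assume "(c *\<^sub>R x, r) \<in> K"
    then have "(x, r / c) \<in> K" using scale[of "1/c" "c *\<^sub>R x" r] that by simp
    then have "?q x \<le> r / c" by (rule le)
    then show "c * ?q x \<le> r" using that by (simp add: field_simps)
  qed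
  have q0: "?q 0 = 0" by (intro antisym le zero ge proper)
  have "?q (c *\<^sub>R x) = c * ?q x" if "0 \<le> c" for c x
  proof (cases "c = 0")
    case True
    then show ?thesis using q0 by simp
  next
    case False
    with that have c: "0 < c" by simp
    have "(1 / c) * ?q (c *\<^sub>R x) \<le> ?q ((1 / c) *\<^sub>R (c *\<^sub>R x))"
      using c by (intro hom_le) auto
    then have "?q (c *\<^sub>R x) \<le> c * ?q x" using c by (simp add: field_simps)
    with hom_le[OF c] show ?thesis by (intro antisym)
  qed
  with sub show "sublinear ?q" by (simp add: sublinear_def)
qed

text \<open>Lowering \<open>p\<close> in the direction \<open>y\<close> gives the sublinear functional
  \<open>q x = (INF t\<ge>0. p (x + t y) - t p y)\<close> below \<open>p\<close>. If \<open>p\<close> is minimal, it equals \<open>q\<close>, and the bound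
  for \<open>t = 1\<close> says that \<open>p\<close> is superadditive in the direction \<open>y\<close>.\<close>

lemma minimal_sublinear_linear:
  assumes p: "sublinear p" and min: "\<And>q. sublinear q \<Longrightarrow> (\<And>x. q x \<le> p x) \<Longrightarrow> q = p"
  shows "linear p"
proof -
  have super: "p x + p y \<le> p (x + y)" for x y
  proof -
    define K where "K = {(x, r). \<exists>t\<ge>0. p (x + t *\<^sub>R y) - t * p y \<le> r}"
    obtain q where q: "sublinear q" "\<And>x r. (x, r) \<in> K \<Longrightarrow> q x \<le> r"
    proof (rule cone_lower_envelope[of K])
      fix x r x' r' assume "(x, r) \<in> K" "(x', r') \<in> K"
      then obtain t t' where t: "t \<ge> 0" "p (x + t *\<^sub>R y) - t * p y \<le> r"
        and t': "t' \<ge> 0" "p (x' + t' *\<^sub>R y) - t' * p y \<le> r'" by (auto simp: K_def)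
      have "p ((x + x') + (t + t') *\<^sub>R y) \<le> p (x + t *\<^sub>R y) + p (x' + t' *\<^sub>R y)"
        using sublinear_add[OF p, of "x + t *\<^sub>R y" "x' + t' *\<^sub>R y"] by (simp add: algebra_simps)
      with t t' have "p ((x + x') + (t + t') *\<^sub>R y) - (t + t') * p y \<le> r + r'"
        by (simp add: algebra_simps)
      with t t' show "(x + x', r + r') \<in> K" unfolding K_def by (auto intro!: exI[of _ "t + t'"])
    next
      fix c :: real and x r assume c: "0 < c" and "(x, r) \<in> K"
      then obtain t where t: "t \<ge> 0" "p (x + t *\<^sub>R y) - t * p y \<le> r" by (auto simp: K_def)
      have "p (c *\<^sub>R x + (c * t) *\<^sub>R y) = c * p (x + t *\<^sub>R y)"
        using sublinear_scale[OF p, of c "x + t *\<^sub>R y"] c by (simp add: algebra_simps)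
      then have "p (c *\<^sub>R x + (c * t) *\<^sub>R y) - (c * t) * p y = c * (p (x + t *\<^sub>R y) - t * p y)"
        by (simp add: algebra_simps)
      also have "\<dots> \<le> c * r" using t c by simp
      finally show "(c *\<^sub>R x, c * r) \<in> K"
        unfolding K_def using t c by (auto intro!: exI[of _ "c * t"])
    next
      show "(0, 0) \<in> K" unfolding K_def using sublinear_zero[OF p] by (auto intro!: exI[of _ 0])
    next
      fix r assume "(0, r) \<in> K"
      then show "0 \<le> r" using sublinear_scale[OF p] by (auto simp: K_def)
    next
      fix x
      have "(x, p x) \<in> K" by (auto simp: K_def intro!: exI[of _ 0])
      then show "\<exists>r. (x, r) \<in> K" by blast
    qed (rule that)
    have "q x \<le> p x" for x
      by (rule q(2)) (auto simp: K_def intro!: exI[of _ 0])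
    then have "q = p" using min q(1) by blast
    moreover have "q x \<le> p (x + y) - p y"
      by (rule q(2)) (auto simp: K_def intro!: exI[of _ 1])
    ultimately show ?thesis by simp
  qed
  have add: "p (x + y) = p x + p y" for x y
    using super sublinear_add[OF p] by (intro antisym)
  have neg: "p (- x) = - p x" for x
    using add[of x "- x"] sublinear_zero[OF p] by simp
  have "p (c *\<^sub>R x) = c * p x" for c x
  proof (cases "0 \<le> c")
    case False
    then have "p (- ((- c) *\<^sub>R x)) = c * p x"
      using neg sublinear_scale[OF p, of "- c" x] by simp
    then show ?thesis by simp
  qed (simp add: sublinear_scale[OF p])
  with add show "linear p" by (intro linearI) auto
qed

text \<open>A minimal sublinear functional exists by Zorn's lemma: in a chain, any two values are
  bounded by values of one common member, which makes the pointwise infimum of the chain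
  sublinear, and it is finite because all members vanish at \<open>0\<close>.\<close>

lemma linear_below_sublinear:
  assumes p: "sublinear p"
  obtains g where "linear g" "\<And>x. g x \<le> p x"
proof -
  define A where "A = {q. sublinear q \<and> (\<forall>x. q x \<le> p x)}"
  let ?P = "\<lambda>(q::'a \<Rightarrow> real) q'. q' \<le> q"
  have "\<exists>m\<in>A. \<forall>a\<in>A. ?P m a \<longrightarrow> a = m"
  proof (rule predicate_Zorn)
    show "partial_order_on A (relation_of ?P A)"
      by (rule partial_order_on_relation_ofI) auto
    fix C assume C: "C \<in> Chains (relation_of ?P A)"
    show "\<exists>u\<in>A. \<forall>a\<in>C. ?P a u"
    proof (cases "C = {}")
      case True
      with p show ?thesis by (auto simp: A_def)
    next
      case False
      have CA: "C \<subseteq> A" and tot: "\<And>q q'. q \<in> C \<Longrightarrow> q' \<in> C \<Longrightarrow> q \<le> q' \<or> q' \<le> q"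
        using C by (auto simp: Chains_def relation_of_def)
      have sl: "sublinear q" if "q \<in> C" for q using CA that by (auto simp: A_def)
      define K where "K = {(x, r). \<exists>q\<in>C. q x \<le> r}"
      obtain u where u: "sublinear u" "\<And>x r. (x, r) \<in> K \<Longrightarrow> u x \<le> r"
      proof (rule cone_lower_envelope[of K])
        fix x r y s assume "(x, r) \<in> K" "(y, s) \<in> K"
        then obtain q q' where q: "q \<in> C" "q' \<in> C" "q x \<le> r" "q' y \<le> s" by (auto simp: K_def)
        obtain q'' where q'': "q'' \<in> C" "q'' x \<le> r" "q'' y \<le> s"
          using tot[OF q(1,2)] q by (metis le_fun_def order_trans)
        then have "q'' (x + y) \<le> r + s" using sublinear_add[OF sl, of q'' x y] by simp
        with q'' show "(x + y, r + s) \<in> K" by (auto simp: K_def)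
      next
        fix c :: real and x r assume "0 < c" "(x, r) \<in> K"
        then show "(c *\<^sub>R x, c * r) \<in> K" by (auto simp: K_def sl sublinear_scale)
      qed (use False in \<open>auto simp: K_def sl sublinear_zero\<close>)
      have uq: "u x \<le> q x" if "q \<in> C" for q x
        using that by (intro u(2)) (auto simp: K_def)
      obtain q where q: "q \<in> C" using False by blast
      then have "u x \<le> p x" for x
        using uq[OF q, of x] CA order_trans by (fastforce simp: A_def)
      with u uq show ?thesis by (auto simp: A_def le_fun_def)
    qed
  qed
  then obtain m where m: "m \<in> A" "\<And>a. a \<in> A \<Longrightarrow> a \<le> m \<Longrightarrow> a = m" by blast
  have "linear m"
  proof (rule minimal_sublinear_linear)
    show "sublinear m" using m by (simp add: A_def)
    fix q assume q: "sublinear q" "\<And>x. q x \<le> m x"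
    have "q x \<le> p x" for x using q(2)[of x] m(1) by (auto simp: A_def intro: order_trans)
    then show "q = m" using q by (intro m(2)) (auto simp: A_def le_fun_def)
  qed
  with m that show thesis by (auto simp: A_def)
qed

text \<open>The functional \<open>p\<close> is first lowered to the largest sublinear functional that is below \<open>p\<close>
  everywhere and below \<open>f\<close> on \<open>M\<close>. A linear functional below that one is at most \<open>f\<close> on the
  subspace \<open>M\<close>, hence equal to \<open>f\<close> there, since \<open>M\<close> contains \<open>- x\<close> along with \<open>x\<close>.\<close>

theorem Hahn_Banach:
  assumes p: "sublinear p" and M: "subspace M"
    and add: "\<And>x y. x \<in> M \<Longrightarrow> y \<in> M \<Longrightarrow> f (x + y) = f x + f y"
    and scale: "\<And>c x. x \<in> M \<Longrightarrow> f (c *\<^sub>R x) = c * f x"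
    and le: "\<And>x. x \<in> M \<Longrightarrow> f x \<le> p x"
  obtains g where "linear g" "\<And>x. x \<in> M \<Longrightarrow> g x = f x" "\<And>x. g x \<le> p x"
proof -
  define K where "K = {(x, r). \<exists>m\<in>M. p (x - m) + f m \<le> r}"
  have f0: "f 0 = 0" using scale[of 0 0] subspace_0[OF M] by simp
  have neg: "f (- m) = - f m" if "m \<in> M" for m using scale[OF that, of "- 1"] by simp
  obtain q where q: "sublinear q" "\<And>x r. (x, r) \<in> K \<Longrightarrow> q x \<le> r"
  proof (rule cone_lower_envelope[of K])
    fix x r y s assume "(x, r) \<in> K" "(y, s) \<in> K"
    then obtain m m' where m: "m \<in> M" "m' \<in> M" "p (x - m) + f m \<le> r" "p (y - m') + f m' \<le> s"
      by (auto simp: K_def)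
    have "p ((x + y) - (m + m')) \<le> p (x - m) + p (y - m')"
      using sublinear_add[OF p, of "x - m" "y - m'"] by (simp add: algebra_simps)
    with m have "p ((x + y) - (m + m')) + f (m + m') \<le> r + s" by (simp add: add)
    with m show "(x + y, r + s) \<in> K" unfolding K_def using subspace_add[OF M] by blast
  next
    fix c :: real and x r assume c: "0 < c" and "(x, r) \<in> K"
    then obtain m where m: "m \<in> M" "p (x - m) + f m \<le> r" by (auto simp: K_def)
    have "p (c *\<^sub>R x - c *\<^sub>R m) + f (c *\<^sub>R m) = c * (p (x - m) + f m)"
      using sublinear_scale[OF p, of c "x - m"] c m by (simp add: scale algebra_simps)
    also have "\<dots> \<le> c * r" using m c by simp
    finally show "(c *\<^sub>R x, c * r) \<in> K"
      unfolding K_def using m subspace_scale[OF M] by blast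
  next
    show "(0, 0) \<in> K" unfolding K_def
      using subspace_0[OF M] f0 sublinear_zero[OF p] by (auto intro!: bexI[of _ 0])
  next
    fix r assume "(0, r) \<in> K"
    then obtain m where m: "m \<in> M" "p (- m) + f m \<le> r" by (auto simp: K_def)
    then show "0 \<le> r" using le[of "- m"] neg[of m] subspace_neg[OF M, of m] by simp
  next
    fix x show "\<exists>r. (x, r) \<in> K" unfolding K_def using subspace_0[OF M] by blast
  qed (rule that)
  obtain g where g: "linear g" "\<And>x. g x \<le> q x"
    using linear_below_sublinear[OF q(1)] by blast
  have qp: "q x \<le> p x" for x
    by (rule q(2)) (use subspace_0[OF M] f0 in \<open>auto simp: K_def intro!: bexI[of _ 0]\<close>)
  have gf: "g x \<le> f x" if "x \<in> M" for x
  proof -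
    have "q x \<le> f x" using that sublinear_zero[OF p]
      by (intro q(2)) (auto simp: K_def intro!: bexI[of _ x])
    with g(2)[of x] show ?thesis by simp
  qed
  have "g x = f x" if "x \<in> M" for x
    using gf[OF that] gf[OF subspace_neg[OF M that]] neg[OF that] linear_neg[OF g(1), of x] by simp
  moreover have "g x \<le> p x" for x using g(2)[of x] qp[of x] by simp
  ultimately show thesis using that g(1) by blast
qed

section \<open>Injectivity of the space of bounded sequences\<close>

lemma apply_Bcontfun_bounded:
  fixes f :: "nat \<Rightarrow> real"
  assumes "\<And>i. \<bar>f i\<bar> \<le> b"
  shows "apply_bcontfun (Bcontfun f) i = f i"
  by (subst Bcontfun_inverse) (use assms in \<open>auto intro!: bcontfun_normI[of _ b]\<close>)

lemma abs_apply_le_norm: "\<bar>apply_bcontfun x i\<bar> \<le> norm (x :: linf)"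
  using norm_bounded[of x i] by simp

lemma norm_linf_le: "(\<And>i. \<bar>apply_bcontfun x i\<bar> \<le> b) \<Longrightarrow> norm (x :: linf) \<le> b"
  by (intro norm_bound) simp

lemma apply_sum: "apply_bcontfun (\<Sum>k\<in>A. f k) i = (\<Sum>k\<in>A. apply_bcontfun (f k :: linf) i)"
  by (induction A rule: infinite_finite_induct) auto

text \<open>An operator into the bounded sequences is a sequence of functionals with a common bound, and
  the Hahn--Banach theorem extends each of them with the same bound. The bound is an arbitrary
  seminorm because the theorem is also needed for the \<open>\<ell>\<^sub>1\<close> norm on coordinate vectors.\<close>

theorem linf_injective:
  fixes S :: "'a::real_vector \<Rightarrow> linf"
  assumes p: "sublinear p" and sym: "\<And>x. p (- x) = p x" and M: "subspace M"
    and add: "\<And>x y. x \<in> M \<Longrightarrow> y \<in> M \<Longrightarrow> S (x + y) = S x + S y"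
    and scale: "\<And>c x. x \<in> M \<Longrightarrow> S (c *\<^sub>R x) = c *\<^sub>R S x"
    and le: "\<And>x. x \<in> M \<Longrightarrow> norm (S x) \<le> p x"
  obtains S' where "linear S'" "\<And>x. x \<in> M \<Longrightarrow> S' x = S x" "\<And>x. norm (S' x) \<le> p x"
proof -
  have "\<exists>g. linear g \<and> (\<forall>x\<in>M. g x = apply_bcontfun (S x) i) \<and> (\<forall>x. g x \<le> p x)" for i
  proof (rule Hahn_Banach[OF p M, of "\<lambda>x. apply_bcontfun (S x) i"])
    fix x assume "x \<in> M"
    then show "apply_bcontfun (S x) i \<le> p x"
      using le[of x] abs_apply_le_norm[of "S x" i] by linarith
  qed (auto simp: add scale)
  then obtain g where g: "\<And>i. linear (g i)" "\<And>i x. x \<in> M \<Longrightarrow> g i x = apply_bcontfun (S x) i"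
    "\<And>i x. g i x \<le> p x" by metis
  have bd: "\<bar>g i x\<bar> \<le> p x" for i x
    using g(3)[of i x] g(3)[of i "- x"] linear_neg[OF g(1), of i x] sym[of x] by simp
  define S' where "S' x = Bcontfun (\<lambda>i. g i x)" for x
  have S': "apply_bcontfun (S' x) i = g i x" for x i
    unfolding S'_def by (rule apply_Bcontfun_bounded[OF bd])
  show thesis
  proof (rule that)
    show "linear S'"
      by (rule linearI; rule bcontfun_eqI) (simp_all add: S' linear_add[OF g(1)] linear_scale[OF g(1)])
    show "S' x = S x" if "x \<in> M" for x by (rule bcontfun_eqI) (simp add: S' g(2) that)
    show "norm (S' x) \<le> p x" for x by (rule norm_linf_le) (simp add: S' bd)
  qed
qed

lemma isometric_embedding_add: "isometric_embedding V N j \<Longrightarrow> x \<in> V \<Longrightarrow> y \<in> V \<Longrightarrow> j (x + y) = j x + j y"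
  and isometric_embedding_scale: "isometric_embedding V N j \<Longrightarrow> x \<in> V \<Longrightarrow> j (c *\<^sub>R x) = c *\<^sub>R j x"
  and isometric_embedding_norm: "isometric_embedding V N j \<Longrightarrow> x \<in> V \<Longrightarrow> norm (j x) = N x"
  by (auto simp: isometric_embedding_def)

lemma isometric_embedding_diff:
  assumes "isometric_embedding V N j" "subspace V" "x \<in> V" "y \<in> V"
  shows "j (x - y) = j x - j y"
  using isometric_embedding_add[OF assms(1), of x "- y"] assms subspace_neg[of V y]
    isometric_embedding_scale[OF assms(1), of y "- 1"] by simp

lemma isometric_embedding_inj:
  assumes "norm_on V N" "isometric_embedding V N j" "subspace V"
  shows "inj_on j V"
proof (rule inj_onI)
  fix x y assume xy: "x \<in> V" "y \<in> V" "j x = j y"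
  then have "N (x - y) = 0"
    using isometric_embedding_diff[OF assms(2,3) xy(1,2)]
      isometric_embedding_norm[OF assms(2) subspace_diff[OF assms(3) xy(1,2)]] by simp
  then show "x = y" using assms(1) subspace_diff[OF assms(3) xy(1,2)] by (auto simp: norm_on_def)
qed

lemma isometric_embedding_subspace:
  assumes "isometric_embedding V N j" "subspace V"
  shows "subspace (j ` V)"
  unfolding subspace_def
proof (intro conjI ballI allI)
  show "0 \<in> j ` V"
    using isometric_embedding_scale[OF assms(1), of 0 0] subspace_0[OF assms(2)]
    by (metis image_eqI scaleR_zero_left)
qed (use assms in \<open>auto simp flip: isometric_embedding_add isometric_embedding_scale
      intro: subspace_add subspace_scale\<close>)

lemma sublinear_scaled_norm:
  fixes b :: real
  assumes "0 \<le> b"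
  shows "sublinear (\<lambda>x::'a::real_normed_vector. b * norm x)"
  using assms by (auto simp: sublinear_def simp flip: distrib_left intro!: mult_left_mono norm_triangle_ineq)

lemma projection_fixes: "projection_onto F P \<Longrightarrow> y \<in> F \<Longrightarrow> P y = y"
  by (auto simp: projection_onto_def fun_eq_iff)

lemma projection_in: "projection_onto F P \<Longrightarrow> P y \<in> F"
  by (auto simp: projection_onto_def)

lemma projection_ontoI:
  assumes "linear P" "\<And>y. norm (P y) \<le> norm y * b" "\<And>y. P y \<in> F" "\<And>y. y \<in> F \<Longrightarrow> P y = y"
  shows "projection_onto F P"
  unfolding projection_onto_def
proof (intro conjI)
  show "bounded_linear P"
    using assms(1,2) by (auto simp: bounded_linear_def bounded_linear_axioms_def)
  show "range P = F" using assms(3,4) by (metis image_subset_iff rangeI subsetI subset_antisym)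
  show "P \<circ> P = P" using assms(3,4) by (auto simp: fun_eq_iff)
qed

text \<open>By injectivity the isomorphism \<open>T\<close>, seen between the two embedded copies, extends to an
  operator on all bounded sequences of norm at most \<open>\<beta>\<close>; following it by \<open>P\<close> and by the inverse of
  \<open>T\<close> gives the new projection. For the identity \<open>T\<close> and \<open>\<alpha> = \<beta> = 1\<close> this is the independence of
  the projection constant from the embedding.\<close>

lemma projection_transfer:
  fixes V1 :: "'a::real_vector set" and V2 :: "'b::real_vector set"
  assumes V1: "subspace V1" "norm_on V1 N1" "isometric_embedding V1 N1 j1"
    and V2: "subspace V2" "norm_on V2 N2" "isometric_embedding V2 N2 j2"
    and T: "\<And>x y. x \<in> V1 \<Longrightarrow> y \<in> V1 \<Longrightarrow> T (x + y) = T x + T y"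
      "\<And>c x. x \<in> V1 \<Longrightarrow> T (c *\<^sub>R x) = c *\<^sub>R T x" "T ` V1 = V2"
    and \<beta>: "\<And>x. x \<in> V1 \<Longrightarrow> N2 (T x) \<le> \<beta> * N1 x" "0 \<le> \<beta>"
    and \<alpha>: "\<And>x. x \<in> V1 \<Longrightarrow> N1 x \<le> \<alpha> * N2 (T x)" "0 \<le> \<alpha>"
    and P: "projection_onto (j2 ` V2) P"
  obtains P' where "projection_onto (j1 ` V1) P'" "onorm P' \<le> \<alpha> * \<beta> * onorm P"
proof -
  note e1 = isometric_embedding_add[OF V1(3)] isometric_embedding_scale[OF V1(3)]
    isometric_embedding_norm[OF V1(3)]
  note e2 = isometric_embedding_add[OF V2(3)] isometric_embedding_scale[OF V2(3)]
    isometric_embedding_norm[OF V2(3)]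
  have TV: "T x \<in> V2" if "x \<in> V1" for x using T(3) that by blast
  have blP: "bounded_linear P" using P by (simp add: projection_onto_def)
  define i where "i = the_inv_into V1 j1"
  have inj: "inj_on j1 V1" by (rule isometric_embedding_inj[OF V1(2,3,1)])
  have i: "i (j1 x) = x" if "x \<in> V1" for x
    unfolding i_def using the_inv_into_f_f[OF inj that] .
  \<comment> \<open>The isomorphism between the embedded copies.\<close>
  define S where "S y = j2 (T (i y))" for y
  have S: "S (j1 x) = j2 (T x)" if "x \<in> V1" for x by (simp add: S_def i that)
  obtain S' where S': "linear S'" "\<And>y. y \<in> j1 ` V1 \<Longrightarrow> S' y = S y" "\<And>y. norm (S' y) \<le> \<beta> * norm y"
  proof (rule linf_injective[OF sublinear_scaled_norm[OF \<beta>(2)] _ isometric_embedding_subspace[OF V1(3,1)]])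
    fix y y' assume "y \<in> j1 ` V1" "y' \<in> j1 ` V1"
    then obtain x x' where x: "x \<in> V1" "x' \<in> V1" "y = j1 x" "y' = j1 x'" by blast
    then have "y + y' = j1 (x + x')" by (simp add: e1)
    then show "S (y + y') = S y + S y'" using x V1(1) by (simp add: S T TV e2 subspace_add)
  next
    fix c y assume "y \<in> j1 ` V1"
    then obtain x where x: "x \<in> V1" "y = j1 x" by blast
    then have "c *\<^sub>R y = j1 (c *\<^sub>R x)" by (simp add: e1)
    then show "S (c *\<^sub>R y) = c *\<^sub>R S y" using x V1(1) by (simp add: S T TV e2 subspace_scale)
  next
    fix y assume "y \<in> j1 ` V1"
    then obtain x where x: "x \<in> V1" "y = j1 x" by blast
    then show "norm (S y) \<le> \<beta> * norm y" using \<beta>(1) by (simp add: S TV e1 e2)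
  qed auto
  have "\<exists>x\<in>V1. j2 (T x) = P (S' y)" for y
    using projection_in[OF P, of "S' y"] T(3) by auto
  then obtain r where r: "\<And>y. r y \<in> V1" "\<And>y. j2 (T (r y)) = P (S' y)" by metis
  \<comment> \<open>The bound by \<open>\<alpha>\<close> makes \<open>T\<close> injective, so \<open>r\<close> is as linear as \<open>P\<close> and \<open>S'\<close>.\<close>
  have uniq: "x = x'" if "x \<in> V1" "x' \<in> V1" "j2 (T x) = j2 (T x')" for x x'
  proof -
    have "T x = T x'"
      using that TV isometric_embedding_inj[OF V2(2,3,1)] by (auto simp: inj_on_def)
    moreover have "T (x - x') = T x - T x'"
      using T(1)[of x "- x'"] T(2)[of x' "- 1"] that subspace_neg[OF V1(1), of x'] by simp
    moreover have d: "x - x' \<in> V1" using subspace_diff V1(1) that by blast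
    moreover have "N2 0 = 0" using V2(1,2) subspace_0 by (auto simp: norm_on_def)
    ultimately have "N1 (x - x') \<le> 0" using \<alpha>(1)[of "x - x'"] by simp
    then have "x - x' = 0" using V1(2) d unfolding norm_on_def by (metis antisym)
    then show ?thesis by simp
  qed
  define P' where "P' y = j1 (r y)" for y
  have Slin: "linear (\<lambda>y. P (S' y))"
    using linear_compose[OF S'(1) bounded_linear.linear[OF blP]] by (simp add: o_def)
  have "linear P'"
  proof (rule linearI)
    fix y y'
    have "r (y + y') = r y + r y'"
      by (rule uniq) (use r V1(1) in \<open>auto simp: T TV e2 linear_add[OF Slin] intro: subspace_add\<close>)
    then show "P' (y + y') = P' y + P' y'" by (simp add: P'_def e1 r)
  next
    fix c y
    have "r (c *\<^sub>R y) = c *\<^sub>R r y"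
      by (rule uniq) (use r V1(1) in \<open>auto simp: T TV e2 linear_scale[OF Slin] intro: subspace_scale\<close>)
    then show "P' (c *\<^sub>R y) = c *\<^sub>R P' y" by (simp add: P'_def e1 r)
  qed
  have bnd: "norm (P' y) \<le> (\<alpha> * \<beta> * onorm P) * norm y" for y
  proof -
    have "norm (P' y) = N1 (r y)" by (simp add: P'_def e1 r)
    also have "\<dots> \<le> \<alpha> * norm (P (S' y))" using \<alpha>(1)[OF r(1), of y] e2(3)[OF TV[OF r(1)], of y] r(2)[of y] by simp
    also have "\<dots> \<le> \<alpha> * (onorm P * norm (S' y))" by (intro mult_left_mono onorm blP \<alpha>)
    also have "\<dots> \<le> \<alpha> * (onorm P * (\<beta> * norm y))"
      by (intro mult_left_mono S' onorm_pos_le blP \<alpha>)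
    finally show ?thesis by (simp add: mult_ac)
  qed
  have "projection_onto (j1 ` V1) P'"
  proof (rule projection_ontoI[OF \<open>linear P'\<close>])
    show "norm (P' y) \<le> norm y * (\<alpha> * \<beta> * onorm P)" for y using bnd[of y] by (simp add: mult_ac)
    show "P' y \<in> j1 ` V1" for y by (simp add: P'_def r)
    fix y assume "y \<in> j1 ` V1"
    then obtain x where x: "x \<in> V1" "y = j1 x" by blast
    then have "P (S' y) = j2 (T x)" using S'(2) S projection_fixes[OF P] TV by simp
    then have "r y = x" using uniq[OF r(1) x(1)] r(2) by simp
    then show "P' y = y" by (simp add: P'_def x)
  qed
  moreover have "onorm P' \<le> \<alpha> * \<beta> * onorm P" 
    by (rule onorm_bound[OF _ bnd]) (intro mult_nonneg_nonneg \<alpha> \<beta> onorm_pos_le blP)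
  ultimately show thesis by (rule that)
qed

text \<open>This fact and the next one describe the projection constant by means of an arbitrary embedding
  instead of the one fixed by the choice operator.\<close>

lemma proj_const_le:
  assumes V: "subspace V" "norm_on V N" and j: "isometric_embedding V N j" and P: "projection_onto (j ` V) P"
  shows "proj_const V N \<le> onorm P"
proof -
  let ?j = "SOME j. isometric_embedding V N j"
  have j': "isometric_embedding V N ?j" using someI_ex[of "isometric_embedding V N"] j by blast
  obtain P' where P': "projection_onto (?j ` V) P'" "onorm P' \<le> 1 * 1 * onorm P"
    by (rule projection_transfer[OF V j' V j, of "\<lambda>x. x" 1 1, OF _ _ _ _ _ _ _ P]) auto
  have "proj_const V N \<le> onorm P'"
    unfolding proj_const_def Let_def
    by (rule cInf_lower) (use P' in \<open>auto simp: bdd_below_def projection_onto_def intro!: exI[of _ 0] onorm_pos_le\<close>)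
  with P' show ?thesis by simp
qed

text \<open>Some projection has to be known to exist, since the infimum of the empty set is an unspecified
  number.\<close>

lemma proj_const_less:
  assumes V: "subspace V" "norm_on V N" and j: "isometric_embedding V N j" and P: "projection_onto (j ` V) P0"
    and c: "proj_const V N < c"
  obtains P where "projection_onto (j ` V) P" "onorm P < c"
proof -
  let ?j = "SOME j. isometric_embedding V N j"
  have j': "isometric_embedding V N ?j" using someI_ex[of "isometric_embedding V N"] j by blast
  obtain P1 where "projection_onto (?j ` V) P1"
    by (rule projection_transfer[OF V j' V j, of "\<lambda>x. x" 1 1, OF _ _ _ _ _ _ _ P]) auto
  then obtain P' where P': "projection_onto (?j ` V) P'" "onorm P' < c"
    using cInf_lessD[OF _ c[unfolded proj_const_def Let_def]] by auto
  obtain P where P: "projection_onto (j ` V) P" "onorm P \<le> 1 * 1 * onorm P'"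
    by (rule projection_transfer[OF V j V j', of "\<lambda>x. x" 1 1, OF _ _ _ _ _ _ _ P'(1)]) auto
  with P'(2) that show thesis by simp
qed

section \<open>Coordinate spaces\<close>

definition coord_vec :: "nat \<Rightarrow> (nat \<Rightarrow> real) \<Rightarrow> linf" where
  "coord_vec d c = Bcontfun (\<lambda>i. if i < d then c i else 0)"

lemma coord_vec_apply: "apply_bcontfun (coord_vec d c) i = (if i < d then c i else 0)"
proof -
  have "\<bar>if k < d then c k else 0\<bar> \<le> (\<Sum>l<d. \<bar>c l\<bar>)" for k
    using member_le_sum[of k "{..<d}" "\<lambda>l. \<bar>c l\<bar>"] by (auto intro: sum_nonneg)
  then show ?thesis unfolding coord_vec_def by (rule apply_Bcontfun_bounded)
qed

definition unit_vec :: "nat \<Rightarrow> linf" where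
  "unit_vec k = coord_vec (Suc k) (\<lambda>i. if i = k then 1 else 0)"

lemma unit_vec_apply: "apply_bcontfun (unit_vec k) i = (if i = k then 1 else 0)"
  by (auto simp: unit_vec_def coord_vec_apply)

lemma coord_vec_in: "coord_vec d c \<in> coord_space d"
  by (simp add: coord_space_def coord_vec_apply)

lemma unit_vec_in: "k < d \<Longrightarrow> unit_vec k \<in> coord_space d"
  by (simp add: coord_space_def unit_vec_apply)

lemma coord_space_apply: "x \<in> coord_space d \<Longrightarrow> d \<le> i \<Longrightarrow> apply_bcontfun x i = 0"
  by (simp add: coord_space_def)

lemma coord_vec_eq_sum: "coord_vec d c = (\<Sum>k<d. c k *\<^sub>R unit_vec k)"
  by (rule bcontfun_eqI) (simp add: apply_sum coord_vec_apply unit_vec_apply if_distrib sum.delta cong: if_cong)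

lemma coord_vec_self: "x \<in> coord_space d \<Longrightarrow> coord_vec d (apply_bcontfun x) = x"
  by (rule bcontfun_eqI) (simp add: coord_vec_apply coord_space_apply)

lemma coord_vec_linear: "linear (\<lambda>x. coord_vec d (apply_bcontfun x))"
  by (rule linearI; rule bcontfun_eqI) (auto simp: coord_vec_apply)

lemma coord_vec_norm_le: "norm (coord_vec d (apply_bcontfun x)) \<le> norm x"
  by (rule norm_linf_le) (simp add: coord_vec_apply abs_apply_le_norm)

lemma subspace_coord_space: "subspace (coord_space d)"
  by (auto simp: subspace_def coord_space_def)

lemma coord_space_expand:
  assumes "x \<in> coord_space d"
  shows "x = (\<Sum>k<d. apply_bcontfun x k *\<^sub>R unit_vec k)"
  using coord_vec_self[OF assms] coord_vec_eq_sum[of d "apply_bcontfun x"] by simp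

lemma linear_coord_expansion:
  fixes f :: "linf \<Rightarrow> 'b::real_vector"
  assumes f: "linear f" and x: "x \<in> coord_space d"
  shows "f x = (\<Sum>k<d. apply_bcontfun x k *\<^sub>R f (unit_vec k))"
  by (subst coord_space_expand[OF x]) (simp only: linear_sum[OF f] linear_scale[OF f])

text \<open>The unit ball is the image of the compact cube \<open>[-1, 1]\<^sup>\<nat>\<close> under a map that is continuous for
  the product topology.\<close>

lemma compact_coord_ball: "compact {x \<in> coord_space d. norm x \<le> 1}"
proof -
  let ?B = "Pi\<^sub>E UNIV (\<lambda>_::nat. {-1..1::real})"
  have "compactin (product_topology (\<lambda>_. euclidean) UNIV) ?B"
    by (subst compactin_PiE) auto
  then have "compact ?B"
    by (simp add: euclidean_product_topology flip: compactin_euclidean_iff)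
  moreover have "continuous_on ?B (coord_vec d)"
    unfolding coord_vec_eq_sum
    by (intro continuous_intros continuous_on_subset[OF continuous_on_product_coordinates]) auto
  ultimately have "compact (coord_vec d ` ?B)" by (rule compact_continuous_image[rotated])
  also have "coord_vec d ` ?B = {x \<in> coord_space d. norm x \<le> 1}"
  proof (intro equalityI subsetI)
    fix x assume "x \<in> coord_vec d ` ?B"
    then obtain c where c: "x = coord_vec d c" "\<And>i. \<bar>c i\<bar> \<le> 1" by (auto simp: PiE_iff abs_le_iff minus_le_iff)
    then show "x \<in> {x \<in> coord_space d. norm x \<le> 1}"
      by (auto simp: coord_vec_in coord_vec_apply intro!: norm_linf_le)
  next
    fix x :: linf assume x: "x \<in> {x \<in> coord_space d. norm x \<le> 1}"
    have "apply_bcontfun x i \<in> {-1..1}" for i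
      using x abs_apply_le_norm[of x i] by auto
    moreover have "x = coord_vec d (apply_bcontfun x)" using x by (simp add: coord_vec_self)
    ultimately show "x \<in> coord_vec d ` ?B" by (auto simp: PiE_iff)
  qed
  finally show ?thesis .
qed

lemma compact_coord_sphere: "compact {x \<in> coord_space d. norm x = 1}"
proof -
  have "{x \<in> coord_space d. norm x = 1} = {x \<in> coord_space d. norm x \<le> 1} \<inter> {x. norm x = 1}" by auto
  moreover have "closed {x::linf. norm x = 1}" by (intro closed_Collect_eq continuous_intros)
  ultimately show ?thesis by (simp only: compact_Int_closed[OF compact_coord_ball])
qed

section \<open>Norms on coordinate spaces\<close>

lemma norm_on_zero: "norm_on V N \<Longrightarrow> subspace V \<Longrightarrow> N 0 = 0"
  by (auto simp: norm_on_def subspace_0)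

lemma norm_on_neg:
  assumes "norm_on V N" "x \<in> V"
  shows "N (- x) = N x"
proof -
  have "N ((- 1) *\<^sub>R x) = \<bar>- 1\<bar> * N x" using assms unfolding norm_on_def by blast
  then show ?thesis by simp
qed

lemma norm_on_scale: "norm_on V N \<Longrightarrow> x \<in> V \<Longrightarrow> N (c *\<^sub>R x) = \<bar>c\<bar> * N x"
  and norm_on_triangle: "norm_on V N \<Longrightarrow> x \<in> V \<Longrightarrow> y \<in> V \<Longrightarrow> N (x + y) \<le> N x + N y"
  and norm_on_nonneg: "norm_on V N \<Longrightarrow> x \<in> V \<Longrightarrow> 0 \<le> N x"
  and norm_on_eq_0: "norm_on V N \<Longrightarrow> x \<in> V \<Longrightarrow> N x = 0 \<Longrightarrow> x = 0"
  by (auto simp: norm_on_def)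

lemma norm_on_diff_ge:
  assumes N: "norm_on V N" and V: "subspace V" and xy: "x \<in> V" "y \<in> V"
  shows "\<bar>N x - N y\<bar> \<le> N (x - y)"
proof -
  have d: "x - y \<in> V" using V xy by (rule subspace_diff)
  have "N x \<le> N (x - y) + N y" using norm_on_triangle[OF N d xy(2)] by simp
  moreover have "N y \<le> N (x - y) + N x"
    using norm_on_triangle[OF N subspace_neg[OF V d] xy(1)] norm_on_neg[OF N d] by simp
  ultimately show ?thesis by linarith
qed

lemma norm_on_sum_le:
  assumes N: "norm_on V N" and V: "subspace V" and v: "\<And>k. k \<in> A \<Longrightarrow> v k \<in> V"
  shows "N (\<Sum>k\<in>A. c k *\<^sub>R v k) \<le> (\<Sum>k\<in>A. \<bar>c k\<bar> * N (v k))"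
  using v
proof (induction A rule: infinite_finite_induct)
  case (insert a A)
  have "N (c a *\<^sub>R v a + (\<Sum>k\<in>A. c k *\<^sub>R v k)) \<le> N (c a *\<^sub>R v a) + N (\<Sum>k\<in>A. c k *\<^sub>R v k)"
    using insert V by (intro norm_on_triangle[OF N] subspace_sum subspace_scale) auto
  with insert show ?case by (simp add: norm_on_scale[OF N])
qed (simp_all add: norm_on_zero[OF N V])

lemma norm_on_coord_space_upper:
  assumes N: "norm_on (coord_space n) N" and x: "x \<in> coord_space n"
  shows "N x \<le> (\<Sum>k<n. N (unit_vec k)) * norm x"
proof -
  have "N x \<le> (\<Sum>k<n. \<bar>apply_bcontfun x k\<bar> * N (unit_vec k))"
    using coord_space_expand[OF x] norm_on_sum_le[OF N subspace_coord_space, of "{..<n}" unit_vec "apply_bcontfun x"]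
    by (simp add: unit_vec_in)
  also have "\<dots> \<le> (\<Sum>k<n. norm x * N (unit_vec k))"
    by (intro sum_mono mult_right_mono abs_apply_le_norm norm_on_nonneg[OF N] unit_vec_in) simp
  finally show ?thesis by (simp add: sum_distrib_left mult.commute)
qed

text \<open>The norm is Lipschitz with respect to the supremum norm, hence attains a positive minimum on the
  compact unit sphere.\<close>

lemma norm_on_coord_space_lower:
  assumes N: "norm_on (coord_space n) N" 
  obtains a where "0 < a" "\<And>x. x \<in> coord_space n \<Longrightarrow> a * norm x \<le> N x"
proof -
  let ?S = "{x \<in> coord_space n. norm x = 1}" and ?b = "\<Sum>k<n. N (unit_vec k)"
  have b: "0 \<le> ?b" by (intro sum_nonneg norm_on_nonneg[OF N] unit_vec_in) simp
  have "?b-lipschitz_on (coord_space n) N"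
  proof (rule lipschitz_onI[OF _ b])
    fix x y assume xy: "x \<in> coord_space n" "y \<in> coord_space n"
    have "dist (N x) (N y) \<le> N (x - y)"
      using norm_on_diff_ge[OF N subspace_coord_space xy] by (simp add: dist_real_def)
    also have "\<dots> \<le> ?b * dist x y"
      unfolding dist_norm using xy subspace_diff[OF subspace_coord_space] by (intro norm_on_coord_space_upper[OF N]) blast
    finally show "dist (N x) (N y) \<le> ?b * dist x y" .
  qed
  then have cont: "continuous_on ?S N"
    by (rule continuous_on_subset[OF lipschitz_on_continuous_on]) auto
  have scaled: "(1 / norm x) *\<^sub>R x \<in> ?S" if "x \<in> coord_space n" "x \<noteq> 0" for x
    using that subspace_scale[OF subspace_coord_space] by auto
  show thesis
  proof (cases "?S = {}")
    case True
    have "x = 0" if "x \<in> coord_space n" for x using scaled[OF that] True by blast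
    then show thesis using norm_on_zero[OF N subspace_coord_space] by (intro that[of 1]) force+
  next
    case False
    obtain u where u: "u \<in> ?S" "\<And>x. x \<in> ?S \<Longrightarrow> N u \<le> N x"
      using continuous_attains_inf[OF compact_coord_sphere False cont] by blast
    have "N u \<noteq> 0" using u(1) norm_on_eq_0[OF N, of u] by auto
    moreover have "0 \<le> N u" using u(1) norm_on_nonneg[OF N] by blast
    moreover have "N u * norm x \<le> N x" if "x \<in> coord_space n" for x
    proof (cases "x = 0")
      case False
      then have "N u \<le> N ((1 / norm x) *\<^sub>R x)" by (intro u scaled that)
      also have "\<dots> = N x / norm x" by (subst norm_on_scale[OF N that]) simp
      finally show ?thesis using False by (simp add: field_simps)
    qed (simp add: norm_on_zero[OF N subspace_coord_space])
    ultimately show thesis by (intro that[of "N u"]) auto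
  qed
qed

lemma norm_on_norm: "norm_on V (norm :: 'a::real_normed_vector \<Rightarrow> real)"
  by (auto simp: norm_on_def intro: norm_triangle_ineq)

lemma isometric_embedding_inclusion: "isometric_embedding V norm (\<lambda>x::linf. x)"
  by (simp add: isometric_embedding_def)

lemma projection_onto_coord_space:
  "projection_onto (coord_space d) (\<lambda>x. coord_vec d (apply_bcontfun x))"
  by (rule projection_ontoI[where b = 1])
    (simp_all add: coord_vec_linear coord_vec_norm_le coord_vec_in coord_vec_self)

text \<open>Composed with the truncation to the first \<open>n\<close> coordinates, \<open>N\<close> is a sublinear functional on the
  whole space of bounded sequences, to which the Hahn--Banach theorem applies.\<close>

lemma norming_functional:
  assumes N: "norm_on (coord_space n) N" and x0: "x0 \<in> coord_space n"
  obtains g where "linear g" "g x0 = N x0" "\<And>x. x \<in> coord_space n \<Longrightarrow> \<bar>g x\<bar> \<le> N x"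
proof -
  let ?p = "\<lambda>x. N (coord_vec n (apply_bcontfun x))"
  have p: "sublinear ?p"
    unfolding sublinear_def linear_add[OF coord_vec_linear] linear_scale[OF coord_vec_linear]
    by (intro conjI allI impI norm_on_triangle[OF N] coord_vec_in) (simp add: norm_on_scale[OF N] coord_vec_in)
  have "\<exists>f. linear f \<and> f x0 = N x0"
  proof (cases "x0 = 0")
    case True
    then show ?thesis using norm_on_zero[OF N subspace_coord_space]
      by (intro exI[of _ "\<lambda>_. 0"]) (simp add: linear_iff)
  next
    case False
    then have "independent {x0}" by simp
    from linear_independent_extend[OF this, of "\<lambda>_. N x0"] show ?thesis by simp
  qed
  then obtain f where f: "linear f" "f x0 = N x0" by blast
  obtain g where g: "linear g" "\<And>x. x \<in> span {x0} \<Longrightarrow> g x = f x" "\<And>x. g x \<le> ?p x"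
  proof (rule Hahn_Banach[OF p, of "span {x0}" f])
    fix x assume "x \<in> span {x0}"
    then obtain c where c: "x = c *\<^sub>R x0" by (auto simp: span_singleton)
    have "f x = c * N x0" using f by (simp add: c linear_scale)
    also have "\<dots> \<le> \<bar>c\<bar> * N x0" by (intro mult_right_mono norm_on_nonneg[OF N x0]) simp
    also have "\<dots> = ?p x"
      using norm_on_scale[OF N x0, of c] subspace_scale[OF subspace_coord_space x0, of c]
      by (simp only: c coord_vec_self)
    finally show "f x \<le> ?p x" .
  qed (use f in \<open>auto simp: linear_add linear_scale\<close>)
  have gN: "g x \<le> N x" if "x \<in> coord_space n" for x
    using g(3)[of x] by (simp add: coord_vec_self that)
  show thesis
  proof (rule that[OF g(1)])
    show "g x0 = N x0" using g(2)[of x0] f by (simp add: span_base)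
    show "\<bar>g x\<bar> \<le> N x" if x: "x \<in> coord_space n" for x
      using gN[OF x] gN[OF subspace_neg[OF subspace_coord_space x]] norm_on_neg[OF N x]
        linear_neg[OF g(1), of x] by simp
  qed
qed

lemma coord_space_separable:
  obtains s :: "nat \<Rightarrow> linf"
  where "\<And>i. s i \<in> coord_space n" "\<And>x e. x \<in> coord_space n \<Longrightarrow> 0 < e \<Longrightarrow> \<exists>i. norm (x - s i) < e"
proof
  \<comment> \<open>The rational vectors, enumerated through their lists of coordinates.\<close>
  let ?s = "\<lambda>i. coord_vec n (\<lambda>k. of_rat ((from_nat i :: rat list) ! k))"
  show "?s i \<in> coord_space n" for i by (rule coord_vec_in)
  fix x :: linf and e :: real assume x: "x \<in> coord_space n" and e: "0 < e"
  have "\<exists>r. \<bar>apply_bcontfun x k - of_rat r\<bar> < e / 2" for k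
  proof -
    obtain r where "apply_bcontfun x k - e / 2 < of_rat r" "of_rat r < apply_bcontfun x k + e / 2"
      using of_rat_dense[of "apply_bcontfun x k - e / 2" "apply_bcontfun x k + e / 2"] e by auto
    then show ?thesis by (intro exI[of _ r]) linarith
  qed
  then obtain r where r: "\<And>k. \<bar>apply_bcontfun x k - of_rat (r k)\<bar> < e / 2" by metis
  let ?i = "to_nat (map r [0..<n])"
  have "norm (x - ?s ?i) \<le> e / 2"
    by (rule norm_linf_le) (use r e in \<open>auto simp: coord_vec_apply coord_space_apply[OF x] intro: less_imp_le\<close>)
  with e show "\<exists>i. norm (x - ?s i) < e" by (intro exI[of _ ?i]) linarith
qed

text \<open>The coordinates of the embedding are norming functionals for a dense sequence. Existence matters
  because the choice operator would otherwise pick a meaningless map.\<close>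

lemma isometric_embedding_exists:
  assumes N: "norm_on (coord_space n) N"
  obtains j where "isometric_embedding (coord_space n) N j"
proof -
  let ?V = "coord_space n"
  note V = subspace_coord_space[of n]
  define b where "b = (\<Sum>k<n. N (unit_vec k)) + 1"
  have "0 \<le> (\<Sum>k<n. N (unit_vec k))"
    by (intro sum_nonneg norm_on_nonneg[OF N] unit_vec_in) simp
  then have b: "0 < b" and Nb: "\<And>x. x \<in> ?V \<Longrightarrow> N x \<le> b * norm x"
    using norm_on_coord_space_upper[OF N] by (auto simp: b_def distrib_right intro: add_increasing2)
  obtain s :: "nat \<Rightarrow> linf" where s: "\<And>i. s i \<in> ?V" "\<And>x e. x \<in> ?V \<Longrightarrow> 0 < e \<Longrightarrow> \<exists>i. norm (x - s i) < e"
    using coord_space_separable by blast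
  have "\<exists>g. linear g \<and> g (s i) = N (s i) \<and> (\<forall>x\<in>?V. \<bar>g x\<bar> \<le> N x)" for i
    using norming_functional[OF N s(1)] by metis
  then obtain g where g: "\<And>i. linear (g i)" "\<And>i. g i (s i) = N (s i)" "\<And>i x. x \<in> ?V \<Longrightarrow> \<bar>g i x\<bar> \<le> N x"
    by metis
  define j where "j x = Bcontfun (\<lambda>i. g i x)" for x
  have j: "apply_bcontfun (j x) i = g i x" if "x \<in> ?V" for x i
    unfolding j_def by (rule apply_Bcontfun_bounded[OF g(3)[OF that]])
  have "norm (j x) = N x" if x: "x \<in> ?V" for x
  proof (rule antisym)
    show "norm (j x) \<le> N x" by (rule norm_linf_le) (simp add: j x g(3))
    show "N x \<le> norm (j x)"
    proof (rule field_le_epsilon)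
      fix e :: real assume e: "0 < e"
      then obtain i where i: "norm (x - s i) < e / (2 * b)" using s(2)[OF x, of "e / (2 * b)"] b by auto
      have d: "x - s i \<in> ?V" using V x s(1) by (rule subspace_diff)
      have "N (x - s i) \<le> e / 2" using Nb[OF d] i b by (simp add: field_simps)
      moreover have "N x \<le> N (x - s i) + N (s i)" using norm_on_triangle[OF N d s(1)[of i]] by simp
      moreover have "N (s i) \<le> g i x + N (x - s i)"
        using g(3)[OF d, of i] g(2)[of i] linear_diff[OF g(1), of i x "s i"] by simp
      moreover have "g i x \<le> norm (j x)" using abs_apply_le_norm[of "j x" i] j[OF x, of i] by simp
      ultimately show "N x \<le> norm (j x) + e" by linarith
    qed
  qed
  moreover have "j (x + y) = j x + j y" if "x \<in> ?V" "y \<in> ?V" for x y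
    by (rule bcontfun_eqI) (simp add: j that subspace_add[OF V] linear_add[OF g(1)])
  moreover have "j (c *\<^sub>R x) = c *\<^sub>R j x" if "x \<in> ?V" for c x
    by (rule bcontfun_eqI) (simp add: j that subspace_scale[OF V] linear_scale[OF g(1)])
  ultimately show thesis by (intro that[of j]) (simp add: isometric_embedding_def)
qed

text \<open>Each point of a finite net of the unit sphere is almost normed by a single coordinate of the
  embedding, and this coordinate still serves for the points nearby.\<close>

lemma finite_coordinates_almost_norming:
  assumes N: "norm_on (coord_space n) N" and j: "isometric_embedding (coord_space n) N j" and e: "0 < e"
  obtains d where "0 < d" "\<And>x. x \<in> coord_space n \<Longrightarrow> \<exists>i<d. (1 - e) * N x \<le> \<bar>apply_bcontfun (j x) i\<bar>"
proof -
  let ?V = "coord_space n" and ?S = "{x \<in> coord_space n. norm x = 1}"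
  note V = subspace_coord_space[of n]
  obtain a where a: "0 < a" "\<And>x. x \<in> ?V \<Longrightarrow> a * norm x \<le> N x"
    using norm_on_coord_space_lower[OF N] by blast
  define b where "b = (\<Sum>k<n. N (unit_vec k))"
  have b: "0 \<le> b"
    unfolding b_def by (intro sum_nonneg norm_on_nonneg[OF N] unit_vec_in) simp
  have Nb: "N x \<le> b * norm x" if "x \<in> ?V" for x
    unfolding b_def by (rule norm_on_coord_space_upper[OF N that])
  \<comment> \<open>Passing to a net of mesh \<open>h\<close> costs \<open>b h\<close> for the norm and \<open>b h\<close> for the coordinate, and choosing
     the coordinate costs \<open>h\<close>; the total may be \<open>e a\<close>, because the norm is at least \<open>a\<close> on the sphere.\<close>
  define h where "h = e * a / (1 + 2 * b)"
  have h: "0 < h" "h * (1 + 2 * b) = e * a" using e a b by (simp_all add: h_def)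
  obtain Y where Y: "finite Y" "Y \<subseteq> ?S" "?S \<subseteq> (\<Union>y\<in>Y. ball y h)"
    using seq_compact_imp_totally_bounded[OF compact_imp_seq_compact[OF compact_coord_sphere], of n] h
    by meson
  have "\<exists>i. N y - h \<le> \<bar>apply_bcontfun (j y) i\<bar>" if "y \<in> Y" for y
  proof (rule ccontr)
    assume "\<not> ?thesis"
    then have "norm (j y) \<le> N y - h" by (intro norm_linf_le) (auto simp: not_le intro: less_imp_le)
    then show False using isometric_embedding_norm[OF j, of y] that Y(2) h by auto
  qed
  then obtain i where i: "\<And>y. y \<in> Y \<Longrightarrow> N y - h \<le> \<bar>apply_bcontfun (j y) (i y)\<bar>" by metis
  define d where "d = Suc (Max (insert 0 (i ` Y)))"
  have id: "i y < d" if "y \<in> Y" for y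
    unfolding d_def less_Suc_eq_le using that Y(1) by (intro Max_ge) auto
  have sph: "\<exists>k<d. (1 - e) * N x \<le> \<bar>apply_bcontfun (j x) k\<bar>" if x: "x \<in> ?S" for x
  proof -
    obtain y where y: "y \<in> Y" "dist y x < h" using Y(3) x by (auto simp: subset_iff)
    have xV: "x \<in> ?V" and yV: "y \<in> ?V" using x y Y(2) by auto
    have d: "x - y \<in> ?V" using V xV yV by (rule subspace_diff)
    have Nd: "N (x - y) \<le> b * h"
      using Nb[OF d] mult_left_mono[OF less_imp_le[OF y(2)] b] by (simp add: dist_norm norm_minus_commute)
    have "\<bar>apply_bcontfun (j (x - y)) (i y)\<bar> \<le> N (x - y)"
      using abs_apply_le_norm[of "j (x - y)" "i y"] isometric_embedding_norm[OF j d] by simp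
    then have "\<bar>apply_bcontfun (j y) (i y)\<bar> \<le> \<bar>apply_bcontfun (j x) (i y)\<bar> + b * h"
      using isometric_embedding_diff[OF j V xV yV] Nd by simp
    moreover have "N x \<le> N y + b * h" using norm_on_diff_ge[OF N V xV yV] Nd by simp
    moreover have "a \<le> N x" using a(2)[OF xV] x by simp
    then have "h * (1 + 2 * b) \<le> e * N x" using h e by simp
    ultimately have "(1 - e) * N x \<le> \<bar>apply_bcontfun (j x) (i y)\<bar>"
      using i[OF y(1)] by (simp add: algebra_simps)
    with id[OF y(1)] show ?thesis by blast
  qed
  show thesis
  proof (rule that)
    show d0: "0 < d" by (simp add: d_def)
    fix x assume x: "x \<in> ?V"
    show "\<exists>i<d. (1 - e) * N x \<le> \<bar>apply_bcontfun (j x) i\<bar>"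
    proof (cases "x = 0")
      case True
      then show ?thesis using d0 norm_on_zero[OF N V] by auto
    next
      case False
      define u where "u = (1 / norm x) *\<^sub>R x"
      have u: "u \<in> ?S" "x = norm x *\<^sub>R u" "u \<in> ?V"
        using x False subspace_scale[OF V x] by (auto simp: u_def)
      obtain k where k: "k < d" "(1 - e) * N u \<le> \<bar>apply_bcontfun (j u) k\<bar>" using sph[OF u(1)] by blast
      have "(1 - e) * N x = norm x * ((1 - e) * N u)"
        by (subst u(2)) (simp add: norm_on_scale[OF N u(3)])
      also have "\<dots> \<le> norm x * \<bar>apply_bcontfun (j u) k\<bar>" using k by (intro mult_left_mono) auto
      also have "\<dots> = \<bar>apply_bcontfun (j x) k\<bar>"
        using isometric_embedding_scale[OF j u(3), of "norm x"] by (simp add: abs_mult flip: u(2))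
      finally show ?thesis using k by blast
    qed
  qed
qed

text \<open>All norms on a coordinate space are equivalent, so the truncation to the first coordinates can
  be transferred along the identity.\<close>

lemma projection_exists_coord_space:
  assumes N: "norm_on (coord_space n) N" and j: "isometric_embedding (coord_space n) N j"
  obtains P where "projection_onto (j ` coord_space n) P"
proof -
  obtain a where a: "0 < a" "\<And>x. x \<in> coord_space n \<Longrightarrow> a * norm x \<le> N x"
    using norm_on_coord_space_lower[OF N] by blast
  obtain P where "projection_onto (j ` coord_space n) P"
  proof (rule projection_transfer[OF subspace_coord_space N j subspace_coord_space norm_on_norm
        isometric_embedding_inclusion, of "\<lambda>x. x" n "1 / a" "\<Sum>k<n. N (unit_vec k)"])
    show "norm x \<le> 1 / a * N x" if "x \<in> coord_space n" for x
      using a(2)[OF that] a(1) by (simp add: field_simps)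
    show "N x \<le> (\<Sum>k<n. N (unit_vec k)) * norm x" if "x \<in> coord_space n" for x
      by (rule norm_on_coord_space_upper[OF N that])
    show "projection_onto ((\<lambda>x. x) ` coord_space n) (\<lambda>x. coord_vec n (apply_bcontfun x))"
      by (simp add: projection_onto_coord_space)
  qed (use a in \<open>auto intro!: sum_nonneg norm_on_nonneg[OF N] unit_vec_in\<close>)
  then show thesis by (rule that)
qed

lemma proj_const_coord_space_less:
  assumes N: "norm_on (coord_space n) N" and j: "isometric_embedding (coord_space n) N j"
    and c: "proj_const (coord_space n) N < c"
  obtains P where "projection_onto (j ` coord_space n) P" "onorm P < c"
proof -
  obtain P0 where "projection_onto (j ` coord_space n) P0"
    by (rule projection_exists_coord_space[OF N j])
  then show thesis by (rule proj_const_less[OF subspace_coord_space N j _ c that])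
qed

text \<open>Projection constants of isomorphic spaces differ at most by the distortion of the isomorphism.\<close>

lemma proj_const_compare:
  assumes N1: "norm_on (coord_space n) N1" and N2: "norm_on (coord_space n) N2"
    and T: "linear T" "T ` coord_space n = coord_space n"
    and \<beta>: "\<And>x. x \<in> coord_space n \<Longrightarrow> N2 (T x) \<le> \<beta> * N1 x" "0 \<le> \<beta>"
    and \<alpha>: "\<And>x. x \<in> coord_space n \<Longrightarrow> N1 x \<le> \<alpha> * N2 (T x)" "0 \<le> \<alpha>"
  shows "proj_const (coord_space n) N1 \<le> \<alpha> * \<beta> * proj_const (coord_space n) N2"
proof -
  let ?V = "coord_space n"
  note V = subspace_coord_space[of n]
  obtain j1 where j1: "isometric_embedding ?V N1 j1" by (rule isometric_embedding_exists[OF N1])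
  obtain j2 where j2: "isometric_embedding ?V N2 j2" by (rule isometric_embedding_exists[OF N2])
  have *: "proj_const ?V N1 \<le> \<alpha> * \<beta> * c" if c: "proj_const ?V N2 < c" for c
  proof -
    obtain P where P: "projection_onto (j2 ` ?V) P" "onorm P < c"
      by (rule proj_const_coord_space_less[OF N2 j2 c])
    obtain P' where P': "projection_onto (j1 ` ?V) P'" "onorm P' \<le> \<alpha> * \<beta> * onorm P"
      by (rule projection_transfer[OF V N1 j1 V N2 j2 _ _ T(2) \<beta> \<alpha> P(1)])
        (auto simp: linear_add[OF T(1)] linear_scale[OF T(1)])
    have "proj_const ?V N1 \<le> onorm P'" by (rule proj_const_le[OF V N1 j1 P'(1)])
    also have "\<dots> \<le> \<alpha> * \<beta> * c" using P' P mult_left_mono[of "onorm P" c "\<alpha> * \<beta>"] \<alpha> \<beta> by simp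
    finally show ?thesis .
  qed
  show ?thesis
  proof (rule tendsto_lowerbound)
    show "((\<lambda>c. \<alpha> * \<beta> * c) \<longlongrightarrow> \<alpha> * \<beta> * proj_const ?V N2) (at_right (proj_const ?V N2))"
      by (intro tendsto_intros)
    show "\<forall>\<^sub>F c in at_right (proj_const ?V N2). proj_const ?V N1 \<le> \<alpha> * \<beta> * c"
      using * by (auto simp: eventually_at_right_field intro: exI[of _ "proj_const ?V N2 + 1"])
  qed simp
qed

lemma proj_const_nonneg:
  assumes N: "norm_on (coord_space n) N"
  shows "0 \<le> proj_const (coord_space n) N"
proof (rule ccontr)
  assume neg: "\<not> ?thesis"
  obtain j where j: "isometric_embedding (coord_space n) N j" by (rule isometric_embedding_exists[OF N])
  obtain P where "projection_onto (j ` coord_space n) P" "onorm P < 0"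
    by (rule proj_const_coord_space_less[OF N j]) (use neg in auto)
  then show False using onorm_pos_le[of P] by (simp add: projection_onto_def)
qed

section \<open>A space with maximal projection constant\<close>

lemma unit_vec_inj: "inj_on unit_vec A"
  by (rule inj_onI) (metis unit_vec_apply zero_neq_one)

lemma sum_unit_vec_apply: "apply_bcontfun (\<Sum>k<n. c k *\<^sub>R unit_vec k) i = (if i < n then c i else 0)"
  by (simp add: coord_vec_apply flip: coord_vec_eq_sum)

lemma independent_unit_vecs: "independent (unit_vec ` {..<n})"
proof (rule independent_if_scalars_zero)
  fix f x assume s: "(\<Sum>v\<in>unit_vec ` {..<n}. f v *\<^sub>R v) = 0" and "x \<in> unit_vec ` {..<n}"
  then obtain k where k: "k < n" "x = unit_vec k" by auto
  have "(\<Sum>l<n. f (unit_vec l) *\<^sub>R unit_vec l) = 0"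
    using s by (simp add: sum.reindex[OF unit_vec_inj])
  then show "f x = 0"
    using sum_unit_vec_apply[of "\<lambda>l. f (unit_vec l)" n k] k by simp
qed auto

lemma coord_space_le_span: "coord_space n \<subseteq> span (unit_vec ` {..<n})"
proof
  fix x assume "x \<in> coord_space n"
  then have "x = (\<Sum>k<n. apply_bcontfun x k *\<^sub>R unit_vec k)" by (rule coord_space_expand)
  also have "\<dots> \<in> span (unit_vec ` {..<n})" by (intro span_sum span_scale span_base) auto
  finally show "x \<in> span (unit_vec ` {..<n})" .
qed

lemma independent_coord_space_bound:
  assumes "independent B" "B \<subseteq> coord_space n"
  shows "finite B \<and> card B \<le> n"
  using independent_span_bound[of "unit_vec ` {..<n}" B] assms coord_space_le_span[of n]
  by (simp add: card_image unit_vec_inj order_trans)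

lemma independent_spans_coord_space:
  assumes "independent B" "B \<subseteq> coord_space n" "card B = n"
  shows "coord_space n \<subseteq> span B"
proof
  fix u assume u: "u \<in> coord_space n"
  show "u \<in> span B"
  proof (rule ccontr)
    assume "u \<notin> span B"
    moreover from this have "u \<notin> B" using span_base by blast
    moreover have "finite B" using independent_coord_space_bound assms by blast
    ultimately show False
      using independent_coord_space_bound[of "insert u B" n] assms u by (simp add: independent_insertI)
  qed
qed

lemma linear_functional_bounded:
  assumes N: "norm_on (coord_space n) N" and g: "linear (g :: linf \<Rightarrow> real)"
  obtains C where "0 < C" "\<And>x. x \<in> coord_space n \<Longrightarrow> \<bar>g x\<bar> \<le> C * N x"
proof -
  obtain a where a: "0 < a" "\<And>x. x \<in> coord_space n \<Longrightarrow> a * norm x \<le> N x"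
    using norm_on_coord_space_lower[OF N] by blast
  define G where "G = (\<Sum>k<n. \<bar>g (unit_vec k)\<bar>) + 1"
  have G: "0 < G" unfolding G_def by (intro add_nonneg_pos sum_nonneg) auto
  have "\<bar>g x\<bar> \<le> (G / a) * N x" if x: "x \<in> coord_space n" for x
  proof -
    have "g x = (\<Sum>k<n. apply_bcontfun x k * g (unit_vec k))"
      using linear_coord_expansion[OF g x] by simp
    then have "\<bar>g x\<bar> \<le> (\<Sum>k<n. norm x * \<bar>g (unit_vec k)\<bar>)"
      by (auto simp: abs_mult intro!: order_trans[OF sum_abs] sum_mono mult_right_mono abs_apply_le_norm)
    also have "\<dots> \<le> G * norm x" by (simp add: G_def sum_distrib_left algebra_simps)
    also have "\<dots> \<le> G * (N x / a)" using a(2)[OF x] a(1) G by (intro mult_left_mono) (simp_all add: field_simps)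
    finally show ?thesis by simp
  qed
  then show thesis using that[of "G / a"] G a by simp
qed

text \<open>Riesz's lemma. The distance from \<open>u\<close> to \<open>W\<close> is positive because a linear functional that
  vanishes on \<open>W\<close> and equals \<open>1\<close> at \<open>u\<close> is bounded with respect to \<open>N\<close>. Subtracting an almost
  nearest point of \<open>W\<close> from \<open>u\<close> and normalising gives the vector.\<close>

lemma riesz_vector:
  assumes N: "norm_on (coord_space n) N" and W: "subspace W" "W \<subseteq> coord_space n"
    and u: "u \<in> coord_space n" "u \<notin> W"
  obtains v where "v \<in> coord_space n" "N v = 1" "\<And>w. w \<in> W \<Longrightarrow> 1 / 2 \<le> N (v - w)"
proof -
  let ?V = "coord_space n"
  note V = subspace_coord_space[of n]
  have WV: "w \<in> ?V" if "w \<in> W" for w using W(2) that by blast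
  obtain B where B: "B \<subseteq> W" "independent B" "W \<subseteq> span B" using basis_exists by metis
  have "span B = W" using B span_minimal[OF B(1) W(1)] by blast
  then have "independent (insert u B)" using B(2) u(2) by (simp add: independent_insert)
  from linear_independent_extend[OF this, of "\<lambda>x. if x = u then 1 else 0 :: real"]
  obtain g where g: "linear g" "\<And>x. x \<in> insert u B \<Longrightarrow> g x = (if x = u then 1 else 0 :: real)"
    by blast
  have gW: "g w = 0" if "w \<in> W" for w
  proof (rule linear_eq_0_on_span[OF g(1)])
    show "w \<in> span B" using B(3) that by blast
    fix x assume "x \<in> B"
    then show "g x = 0" using g(2)[of x] B(1) u(2) by auto
  qed
  obtain C where C: "0 < C" "\<And>x. x \<in> ?V \<Longrightarrow> \<bar>g x\<bar> \<le> C * N x" 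
    using linear_functional_bounded[OF N g(1)] by blast
  have low: "1 / C \<le> N (u - w)" if "w \<in> W" for w
  proof -
    have "g (u - w) = 1" using g(2)[of u] gW[OF that] by (simp add: linear_diff[OF g(1)])
    then show ?thesis using C(2)[OF subspace_diff[OF V u(1) WV[OF that]]] C(1) by (simp add: field_simps)
  qed
  define \<delta> where "\<delta> = (INF w\<in>W. N (u - w))"
  have ne: "W \<noteq> {}" using subspace_0[OF W(1)] by blast
  have "1 / C \<le> \<delta>" unfolding \<delta>_def by (rule cINF_greatest[OF ne low])
  then have \<delta>: "0 < \<delta>" using C(1) by (smt (verit) divide_pos_pos)
  have \<delta>le: "\<delta> \<le> N (u - w)" if "w \<in> W" for w
    unfolding \<delta>_def by (rule cINF_lower) (use low that in \<open>auto simp: bdd_below_def\<close>)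
  have "\<exists>w\<in>W. N (u - w) < 2 * \<delta>"
    using cInf_lessD[of "(\<lambda>w. N (u - w)) ` W" "2 * \<delta>"] ne \<delta> unfolding \<delta>_def by auto
  then obtain w where w: "w \<in> W" "N (u - w) < 2 * \<delta>" by blast
  define y where "y = u - w"
  have y: "y \<in> ?V" "\<delta> \<le> N y" "N y < 2 * \<delta>"
    using w \<delta>le[OF w(1)] subspace_diff[OF V u(1) WV[OF w(1)]] by (auto simp: y_def)
  define v where "v = (1 / N y) *\<^sub>R y"
  have v: "v \<in> ?V" unfolding v_def by (rule subspace_scale[OF V y(1)])
  have yv: "y = N y *\<^sub>R v" using y \<delta> by (simp add: v_def)
  show thesis
  proof (rule that[OF v])
    show "N v = 1" unfolding v_def using norm_on_scale[OF N y(1)] y \<delta> by simp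
    fix w' assume w': "w' \<in> W"
    have vw: "v - w' \<in> ?V" using V v WV[OF w'] by (rule subspace_diff)
    have "N y * N (v - w') = N (N y *\<^sub>R (v - w'))" using norm_on_scale[OF N vw] y \<delta> by simp
    also have "N y *\<^sub>R (v - w') = u - (w + N y *\<^sub>R w')"
      by (simp add: scaleR_diff_right flip: yv) (simp add: y_def)
    also have "\<delta> \<le> N (u - (w + N y *\<^sub>R w'))"
      using w(1) w' W(1) by (intro \<delta>le subspace_add subspace_scale)
    finally have "\<delta> \<le> N y * N (v - w')" .
    moreover have "N y * N (v - w') \<le> 2 * \<delta> * N (v - w')"
      using y norm_on_nonneg[OF N vw] by (intro mult_right_mono) auto
    ultimately have "\<delta> * 1 \<le> \<delta> * (2 * N (v - w'))" by simp
    then show "1 / 2 \<le> N (v - w')" using \<delta> by (simp only: mult_le_cancel_left_pos)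
  qed
qed

text \<open>Riesz vectors are chosen one after the other. The coefficient of the last one is at most twice
  the norm of a combination, so dropping its term at most triples the norm, which gives the
  factor \<open>3 ^ m\<close>. An Auerbach basis would have the factor \<open>1\<close>, but all that matters below is that
  the factor is the same for all norms.\<close>

lemma almost_auerbach_system:
  assumes N: "norm_on (coord_space n) N" and m: "m \<le> n"
  shows "\<exists>v. (\<forall>k<m. v k \<in> coord_space n \<and> N (v k) = 1) \<and>
    (\<forall>c. \<forall>k<m. \<bar>c k\<bar> \<le> 3 ^ m * N (\<Sum>l<m. c l *\<^sub>R v l))"
  using m
proof (induction m)
  case (Suc m)
  let ?V = "coord_space n"
  note V = subspace_coord_space[of n]
  obtain v where v: "\<And>k. k < m \<Longrightarrow> v k \<in> ?V" "\<And>k. k < m \<Longrightarrow> N (v k) = 1"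
    "\<And>c k. k < m \<Longrightarrow> \<bar>c k\<bar> \<le> 3 ^ m * N (\<Sum>l<m. c l *\<^sub>R v l)"
    using Suc by auto
  define W where "W = span (v ` {..<m})"
  have WV: "W \<subseteq> ?V" unfolding W_def using v(1) by (intro span_minimal V) auto
  have "\<not> ?V \<subseteq> W"
  proof
    assume "?V \<subseteq> W"
    then have "dim ?V \<le> card (v ` {..<m})" unfolding W_def by (intro dim_le_card) auto
    also have "\<dots> \<le> m" using card_image_le[of "{..<m}" v] by simp
    finally show False using Suc.prems by (simp add: dim_coord_space)
  qed
  then obtain u where "u \<in> ?V" "u \<notin> W" by blast
  then obtain z where z: "z \<in> ?V" "N z = 1" "\<And>w. w \<in> W \<Longrightarrow> 1 / 2 \<le> N (z - w)"
    using riesz_vector[OF N _ WV] by (auto simp: W_def)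
  let ?v = "v(m := z)"
  have bound: "\<bar>c k\<bar> \<le> 3 ^ Suc m * N (\<Sum>l<Suc m. c l *\<^sub>R ?v l)" if k: "k < Suc m" for c k
  proof -
    define x where "x = (\<Sum>l<m. c l *\<^sub>R v l)"
    have x: "x \<in> W" unfolding x_def W_def by (intro span_sum span_scale span_base) auto
    then have xV: "x \<in> ?V" using WV by blast
    define s where "s = (\<Sum>l<Suc m. c l *\<^sub>R ?v l)"
    have s: "s = x + c m *\<^sub>R z" unfolding s_def x_def by simp
    have sV: "s \<in> ?V" unfolding s by (intro subspace_add subspace_scale V xV z)
    have Ns: "0 \<le> N s" by (rule norm_on_nonneg[OF N sV])
    have cm: "\<bar>c m\<bar> \<le> 2 * N s"
    proof (cases "c m = 0")
      case False
      have "- ((1 / c m) *\<^sub>R x) \<in> W" using x unfolding W_def by (intro span_neg span_scale)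
      from z(3)[OF this] have half: "1 / 2 \<le> N (z + (1 / c m) *\<^sub>R x)" by simp
      have "z + (1 / c m) *\<^sub>R x \<in> ?V" by (intro subspace_add subspace_scale V xV z)
      from norm_on_scale[OF N this, of "c m"] have "N s = \<bar>c m\<bar> * N (z + (1 / c m) *\<^sub>R x)"
        using False by (simp add: s scaleR_add_right add.commute)
      with mult_left_mono[OF half, of "\<bar>c m\<bar>"] show ?thesis by simp
    qed (use Ns in simp)
    have "N x \<le> N s + N (- (c m *\<^sub>R z))"
      using norm_on_triangle[OF N sV, of "- (c m *\<^sub>R z)"] z(1) V by (simp add: s subspace_neg subspace_scale)
    also have "N (- (c m *\<^sub>R z)) = \<bar>c m\<bar>"
      using z(1,2) V by (simp add: norm_on_neg[OF N] norm_on_scale[OF N] subspace_scale)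
    finally have Nx: "N x \<le> 3 * N s" using cm by simp
    have "\<bar>c k\<bar> \<le> 3 ^ Suc m * N s"
    proof (cases "k = m")
      case True
      have "(2::real) \<le> 3 ^ Suc m" using one_le_power[of "3::real" m] unfolding power_Suc by linarith
      then have "2 * N s \<le> 3 ^ Suc m * N s" using Ns by (rule mult_right_mono)
      with cm True show ?thesis by simp
    next
      case False
      then have "\<bar>c k\<bar> \<le> 3 ^ m * N x" using k v(3)[of k c] by (simp add: x_def)
      also have "\<dots> \<le> 3 ^ m * (3 * N s)" using Nx by (intro mult_left_mono) auto
      finally show ?thesis by simp
    qed
    then show ?thesis by (simp add: s_def)
  qed
  show ?case
    using v z bound by (intro exI[of _ ?v] conjI allI impI) (auto simp: less_Suc_eq)
qed auto

text \<open>Up to isometry, every norm on the coordinate space lies between two multiples of the supremum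
  norm that depend on \<open>n\<close> only. This brings all \<open>n\<close>-dimensional spaces into one compact family.\<close>

lemma norm_normal_form:
  assumes N: "norm_on (coord_space n) N"
  obtains T where "linear T" "T ` coord_space n = coord_space n"
    "\<And>x. x \<in> coord_space n \<Longrightarrow> (1 / 3 ^ n) * norm x \<le> N (T x)"
    "\<And>x. x \<in> coord_space n \<Longrightarrow> N (T x) \<le> (real n + 1) * norm x"
proof -
  let ?V = "coord_space n"
  note V = subspace_coord_space[of n]
  obtain v where v: "\<And>k. k < n \<Longrightarrow> v k \<in> ?V" "\<And>k. k < n \<Longrightarrow> N (v k) = 1"
    "\<And>c k. k < n \<Longrightarrow> \<bar>c k\<bar> \<le> 3 ^ n * N (\<Sum>l<n. c l *\<^sub>R v l)"
    using almost_auerbach_system[OF N order_refl] by auto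
  define T where "T x = (\<Sum>k<n. apply_bcontfun x k *\<^sub>R v k)" for x
  have T: "linear T"
    by (rule linearI) (simp_all add: T_def scaleR_add_left sum.distrib scaleR_sum_right)
  have TV: "T x \<in> ?V" for x unfolding T_def by (intro subspace_sum subspace_scale V v) simp
  have low: "(1 / 3 ^ n) * norm x \<le> N (T x)" if x: "x \<in> ?V" for x
  proof -
    have "norm x \<le> 3 ^ n * N (T x)"
    proof (rule norm_linf_le)
      fix i show "\<bar>apply_bcontfun x i\<bar> \<le> 3 ^ n * N (T x)"
        using v(3)[of i "apply_bcontfun x"] coord_space_apply[OF x, of i] norm_on_nonneg[OF N TV[of x]]
        by (cases "i < n") (auto simp: T_def)
    qed
    then show ?thesis by (simp add: field_simps)
  qed
  have up: "N (T x) \<le> (real n + 1) * norm x" if x: "x \<in> ?V" for x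
  proof -
    have "N (T x) \<le> (\<Sum>k<n. \<bar>apply_bcontfun x k\<bar> * N (v k))"
      unfolding T_def by (rule norm_on_sum_le[OF N V]) (simp add: v)
    also have "\<dots> \<le> (\<Sum>k<n. norm x)" by (intro sum_mono) (simp add: v abs_apply_le_norm)
    also have "\<dots> \<le> (real n + 1) * norm x" by (simp add: distrib_right)
    finally show ?thesis .
  qed
  have inj: "inj_on T ?V"
  proof (rule inj_onI)
    fix x y assume xy: "x \<in> ?V" "y \<in> ?V" "T x = T y"
    then have "T (x - y) = 0" by (simp add: linear_diff[OF T])
    then show "x = y"
      using low[OF subspace_diff[OF V xy(1,2)]] norm_on_zero[OF N V] by (simp add: field_simps)
  qed
  have units: "unit_vec ` {..<n} \<subseteq> ?V" using unit_vec_in by auto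
  have "independent (T ` unit_vec ` {..<n})"
    using span_minimal[OF units V] inj
    by (intro linear_independent_injective_image T independent_unit_vecs) (blast intro: inj_on_subset)
  moreover have "card (T ` unit_vec ` {..<n}) = n"
    using inj_on_subset[OF inj units] by (simp add: card_image unit_vec_inj)
  moreover have "T ` unit_vec ` {..<n} \<subseteq> ?V" using TV by auto
  ultimately have "?V \<subseteq> span (T ` unit_vec ` {..<n})"
    by (intro independent_spans_coord_space) auto
  also have "\<dots> \<subseteq> T ` ?V"
    by (intro span_minimal linear_subspace_image T V image_mono units)
  finally have "T ` ?V = ?V" using TV by blast
  then show thesis by (rule that[OF T _ low up])
qed

text \<open>The value \<open>0\<close> outside the coordinate space makes a norm on that space a unique point of a product
  of compact intervals.\<close>

definition pinched_norms :: "nat \<Rightarrow> real \<Rightarrow> real \<Rightarrow> (linf \<Rightarrow> real) set" where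
  "pinched_norms n a b = {N. norm_on (coord_space n) N \<and>
     (\<forall>x. N x \<in> (if x \<in> coord_space n then {a * norm x..b * norm x} else {0}))}"

text \<open>Each condition in the definition of a norm is closed in the product topology, since it involves
  only finitely many values of \<open>N\<close>; only definiteness is not, and it follows from the lower bound.
  The bounds themselves give a product of compact sets.\<close>

lemma compact_pinched_norms:
  assumes a: "0 < a"
  shows "compact (pinched_norms n a b)"
proof -
  let ?V = "coord_space n"
  let ?I = "\<lambda>x::linf. if x \<in> ?V then {a * norm x..b * norm x} else {0}"
  have "compactin (product_topology (\<lambda>_. euclidean) UNIV) (Pi\<^sub>E UNIV ?I)"
    by (subst compactin_PiE) auto
  then have box: "compact (Pi\<^sub>E UNIV ?I)"
    by (simp add: euclidean_product_topology flip: compactin_euclidean_iff)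
  let ?H = "{N :: linf \<Rightarrow> real. \<forall>x c. x \<in> ?V \<longrightarrow> N (c *\<^sub>R x) = \<bar>c\<bar> * N x}"
  let ?T = "{N :: linf \<Rightarrow> real. \<forall>x y. x \<in> ?V \<longrightarrow> y \<in> ?V \<longrightarrow> N (x + y) \<le> N x + N y}"
  have "closed ?H"
    by (intro closed_Collect_all closed_Collect_imp open_Collect_const closed_Collect_eq
        continuous_intros continuous_on_product_coordinates)
  moreover have "closed ?T"
    by (intro closed_Collect_all closed_Collect_imp open_Collect_const closed_Collect_le
        continuous_intros continuous_on_product_coordinates)
  moreover have "pinched_norms n a b = Pi\<^sub>E UNIV ?I \<inter> (?H \<inter> ?T)"
  proof (intro equalityI subsetI)
    fix N assume "N \<in> pinched_norms n a b"
    then show "N \<in> Pi\<^sub>E UNIV ?I \<inter> (?H \<inter> ?T)"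
      by (simp add: pinched_norms_def norm_on_def PiE_iff)
  next
    fix N assume N: "N \<in> Pi\<^sub>E UNIV ?I \<inter> (?H \<inter> ?T)"
    have box: "N x \<in> ?I x" for x using N by (auto simp: PiE_iff)
    have "0 \<le> N x \<and> (N x = 0 \<longleftrightarrow> x = 0)" if x: "x \<in> ?V" for x
    proof -
      have le: "a * norm x \<le> N x" "N x \<le> b * norm x" using box[of x] x by auto
      have "0 \<le> a * norm x" using a by simp
      moreover have "0 < a * norm x" if "x \<noteq> 0" using a that by simp
      ultimately show ?thesis using le by (cases "x = 0") auto
    qed
    with N have "norm_on ?V N" by (simp add: norm_on_def)
    with box show "N \<in> pinched_norms n a b" by (simp add: pinched_norms_def)
  qed
  ultimately show ?thesis
    using compact_Int_closed[OF box closed_Int] by simp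
qed

text \<open>Closeness at the finitely many points of a net of the sphere implies closeness on the whole
  sphere, because all norms in the family have the same Lipschitz constant \<open>b\<close>. This is how the
  product topology controls the distance of norms.\<close>

lemma pinched_norms_nhd:
  assumes N: "N \<in> pinched_norms n a b" and b: "0 \<le> b" and \<delta>: "0 < \<delta>"
  obtains U where "open U" "N \<in> U"
    "\<And>M x. M \<in> U \<Longrightarrow> M \<in> pinched_norms n a b \<Longrightarrow> x \<in> coord_space n \<Longrightarrow> \<bar>M x - N x\<bar> \<le> \<delta> * norm x"
proof -
  let ?V = "coord_space n" and ?S = "{x \<in> coord_space n. norm x = 1}"
  note V = subspace_coord_space[of n]
  define h where "h = \<delta> / (2 * b + 1)"
  have h: "0 < h" "h * (2 * b + 1) = \<delta>" using \<delta> b by (auto simp: h_def)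
  obtain Y where Y: "finite Y" "Y \<subseteq> ?S" "?S \<subseteq> (\<Union>y\<in>Y. ball y h)"
    using seq_compact_imp_totally_bounded[OF compact_imp_seq_compact[OF compact_coord_sphere], of n] h
    by meson
  define U where "U = (\<Inter>y\<in>Y. {M :: linf \<Rightarrow> real. \<bar>M y - N y\<bar> < h})"
  show thesis
  proof (rule that)
    show "open U" unfolding U_def using Y(1)
      by (intro open_INT open_Collect_less ballI continuous_intros continuous_on_product_coordinates)
    show "N \<in> U" using h by (simp add: U_def)
    fix M x assume M: "M \<in> U" "M \<in> pinched_norms n a b" and x: "x \<in> ?V"
    have nM: "norm_on ?V M" and nN: "norm_on ?V N" using M N by (auto simp: pinched_norms_def)
    have ub: "L z \<le> b * norm z" if "L \<in> pinched_norms n a b" "z \<in> ?V" for L z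
      using that by (auto simp: pinched_norms_def dest!: spec[of _ z])
    show "\<bar>M x - N x\<bar> \<le> \<delta> * norm x"
    proof (cases "x = 0")
      case True
      then show ?thesis using norm_on_zero[OF nM V] norm_on_zero[OF nN V] by simp
    next
      case False
      define u where "u = (1 / norm x) *\<^sub>R x"
      have u: "u \<in> ?S" "u \<in> ?V" "x = norm x *\<^sub>R u"
        using x False subspace_scale[OF V x] by (auto simp: u_def)
      obtain y where y: "y \<in> Y" "dist y u < h" using Y(3) u(1) by (auto simp: subset_iff)
      have yV: "y \<in> ?V" using y(1) Y(2) by blast
      have d: "u - y \<in> ?V" using V u(2) yV by (rule subspace_diff)
      have dh: "b * norm (u - y) \<le> b * h"
        using y(2) b by (intro mult_left_mono) (simp_all add: dist_norm norm_minus_commute)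
      have "\<bar>M u - M y\<bar> \<le> b * h" using norm_on_diff_ge[OF nM V u(2) yV] ub[OF M(2) d] dh by linarith
      moreover have "\<bar>N u - N y\<bar> \<le> b * h" using norm_on_diff_ge[OF nN V u(2) yV] ub[OF N d] dh by linarith
      moreover have "\<bar>M y - N y\<bar> < h" using M(1) y(1) by (simp add: U_def)
      ultimately have "\<bar>M u - N u\<bar> \<le> \<delta>" unfolding h(2)[symmetric] by (simp add: algebra_simps)
      moreover have "M x - N x = norm x * (M u - N u)"
        using norm_on_scale[OF nM u(2), of "norm x"] norm_on_scale[OF nN u(2), of "norm x"]
        by (simp add: right_diff_distrib flip: u(3))
      ultimately show ?thesis
        using mult_left_mono[of "\<bar>M u - N u\<bar>" \<delta> "norm x"] by (simp add: abs_mult mult.commute)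
    qed
  qed
qed

lemma proj_const_close:
  assumes N: "N \<in> pinched_norms n a b" and M: "M \<in> pinched_norms n a b" and a: "0 < a" and t: "0 \<le> t"
    and close: "\<And>x. x \<in> coord_space n \<Longrightarrow> \<bar>M x - N x\<bar> \<le> a * t * norm x"
  shows "proj_const (coord_space n) M \<le> (1 + t)\<^sup>2 * proj_const (coord_space n) N"
proof -
  have nM: "norm_on (coord_space n) M" and nN: "norm_on (coord_space n) N"
    using M N by (auto simp: pinched_norms_def)
  have lb: "a * norm z \<le> L z" if "L \<in> pinched_norms n a b" "z \<in> coord_space n" for L z
    using that by (auto simp: pinched_norms_def dest!: spec[of _ z])
  have le: "a * t * norm x \<le> t * L x" if "L \<in> pinched_norms n a b" "x \<in> coord_space n" for L x
    using mult_left_mono[OF lb[OF that] t] by (simp add: mult_ac)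
  have "M x \<le> (1 + t) * N x" if "x \<in> coord_space n" for x
    using close[OF that] le[OF N that] by (simp add: distrib_right)
  moreover have "N x \<le> (1 + t) * M x" if "x \<in> coord_space n" for x
    using close[OF that] le[OF M that] by (simp add: distrib_right)
  ultimately have "proj_const (coord_space n) M \<le> (1 + t) * (1 + t) * proj_const (coord_space n) N"
    using t by (intro proj_const_compare[OF nM nN linear_id]) auto
  then show ?thesis by (simp add: power2_eq_square)
qed

lemma continuous_on_proj_const:
  assumes a: "0 < a" and b: "0 \<le> b"
  shows "continuous_on (pinched_norms n a b) (proj_const (coord_space n))"
  unfolding continuous_on_def
proof (intro ballI tendstoI)
  fix N :: "linf \<Rightarrow> real" and e :: real assume N: "N \<in> pinched_norms n a b" and e: "0 < e"
  let ?\<Pi> = "proj_const (coord_space n)"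
  have nonneg: "0 \<le> ?\<Pi> L" if "L \<in> pinched_norms n a b" for L
    using that by (intro proj_const_nonneg) (simp add: pinched_norms_def)
  have "((\<lambda>t. ((1 + t)\<^sup>2 - 1) * (1 + t)\<^sup>2 * ?\<Pi> N) \<longlongrightarrow> ((1 + 0)\<^sup>2 - 1) * (1 + 0)\<^sup>2 * ?\<Pi> N) (at_right 0)"
    by (intro tendsto_intros)
  then have "\<forall>\<^sub>F t in at_right 0. ((1 + t)\<^sup>2 - 1) * (1 + t)\<^sup>2 * ?\<Pi> N < e"
    using e by (intro order_tendstoD(2)) simp_all
  moreover have "\<forall>\<^sub>F t::real in at_right 0. 0 < t" by (rule eventually_at_right_less)
  ultimately have "\<forall>\<^sub>F t in at_right 0. 0 < t \<and> ((1 + t)\<^sup>2 - 1) * (1 + t)\<^sup>2 * ?\<Pi> N < e"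
    by eventually_elim simp
  then obtain t where t: "0 < t" "((1 + t)\<^sup>2 - 1) * (1 + t)\<^sup>2 * ?\<Pi> N < e"
    using eventually_happens'[OF trivial_limit_at_right_real] by blast
  obtain U where U: "open U" "N \<in> U"
    "\<And>M x. M \<in> U \<Longrightarrow> M \<in> pinched_norms n a b \<Longrightarrow> x \<in> coord_space n \<Longrightarrow> \<bar>M x - N x\<bar> \<le> a * t * norm x"
    using pinched_norms_nhd[OF N b mult_pos_pos[OF a t(1)]] by blast
  have "dist (?\<Pi> M) (?\<Pi> N) < e" if M: "M \<in> U" "M \<in> pinched_norms n a b" for M
  proof -
    define s where "s = (1 + t)\<^sup>2"
    have s: "1 \<le> s" using t(1) by (simp add: s_def)
    have MN: "?\<Pi> M \<le> s * ?\<Pi> N" 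
      unfolding s_def by (rule proj_const_close[OF N M(2) a]) (use t U(3)[OF M] in auto)
    have NM: "?\<Pi> N \<le> s * ?\<Pi> M"
      unfolding s_def
      by (rule proj_const_close[OF M(2) N a]) (use t U(3)[OF M] in \<open>auto simp: abs_minus_commute\<close>)
    have "?\<Pi> M - ?\<Pi> N \<le> (s - 1) * ?\<Pi> N" using MN by (simp add: algebra_simps)
    also have "\<dots> \<le> (s - 1) * s * ?\<Pi> N"
      using s nonneg[OF N] mult_left_mono[of 1 s "s - 1"] by (intro mult_right_mono) simp_all
    finally have 1: "?\<Pi> M - ?\<Pi> N < e" using t(2) by (simp add: s_def)
    have "?\<Pi> N - ?\<Pi> M \<le> (s - 1) * ?\<Pi> M" using NM by (simp add: algebra_simps)
    also have "\<dots> \<le> (s - 1) * (s * ?\<Pi> N)" using s MN by (intro mult_left_mono) auto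
    finally have "?\<Pi> N - ?\<Pi> M < e" using t(2) by (simp add: s_def mult.assoc)
    with 1 show ?thesis by (simp add: dist_real_def)
  qed
  then show "\<forall>\<^sub>F M in at N within pinched_norms n a b. dist (?\<Pi> M) (?\<Pi> N) < e"
    unfolding eventually_at_topological using U(1,2) by blast
qed

text \<open>The projection constant is continuous on a compact family of norms that contains a norm
  isometric to each norm on the coordinate space. In particular the greatest value in the definition exists.\<close>

lemma max_proj_const_attained:
  obtains N where "norm_on (coord_space n) N" "proj_const (coord_space n) N = max_proj_const n"
    "\<And>M. norm_on (coord_space n) M \<Longrightarrow> proj_const (coord_space n) M \<le> max_proj_const n"
proof -
  let ?V = "coord_space n" and ?a = "1 / 3 ^ n :: real" and ?b = "real n + 1"
  let ?\<Pi> = "proj_const (coord_space n)"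
  let ?K = "pinched_norms n ?a ?b"
  have pos3: "\<not> 3 ^ n \<le> (0::real)" by (simp add: not_le)
  have equiv: "\<exists>M'\<in>?K. ?\<Pi> M \<le> ?\<Pi> M'" if M: "norm_on ?V M" for M
  proof -
    obtain T where T: "linear T" "T ` ?V = ?V" "\<And>x. x \<in> ?V \<Longrightarrow> ?a * norm x \<le> M (T x)"
      "\<And>x. x \<in> ?V \<Longrightarrow> M (T x) \<le> ?b * norm x"
      using norm_normal_form[OF M] by metis
    define M' where "M' x = (if x \<in> ?V then M (T x) else 0)" for x
    note V = subspace_coord_space[of n]
    have TV: "T x \<in> ?V" if "x \<in> ?V" for x using T(2) that by blast
    have M': "norm_on ?V M'"
      unfolding norm_on_def
    proof (intro conjI ballI allI)
      fix x assume x: "x \<in> ?V"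
      show "0 \<le> M' x" using norm_on_nonneg[OF M TV[OF x]] x by (simp add: M'_def)
      show "M' x = 0 \<longleftrightarrow> x = 0"
      proof
        assume "M' x = 0"
        then have "?a * norm x \<le> 0" using T(3)[OF x] x by (simp add: M'_def)
        then show "x = 0" by (simp add: divide_le_0_iff pos3)
      next
        assume "x = 0"
        then show "M' x = 0" using linear_0[OF T(1)] norm_on_zero[OF M V] by (simp add: M'_def)
      qed
      show "M' (c *\<^sub>R x) = \<bar>c\<bar> * M' x" for c
        using x norm_on_scale[OF M TV[OF x]] subspace_scale[OF V x] by (simp add: M'_def linear_scale[OF T(1)])
      fix y assume y: "y \<in> ?V"
      show "M' (x + y) \<le> M' x + M' y"
        using x y norm_on_triangle[OF M TV[OF x] TV[OF y]] subspace_add[OF V x y]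
        by (simp add: M'_def linear_add[OF T(1)])
    qed
    have "M' \<in> ?K" using M' T by (auto simp: pinched_norms_def M'_def)
    moreover have "?\<Pi> M \<le> ?\<Pi> M'"
    proof -
      obtain S where S: "linear S" "\<And>x. x \<in> ?V \<Longrightarrow> S (T x) = x"
      proof -
        have "inj_on T ?V"
        proof (rule inj_onI)
          fix x y assume xy: "x \<in> ?V" "y \<in> ?V" "T x = T y"
          have "?a * norm (x - y) \<le> M (T (x - y))" using xy V by (intro T subspace_diff)
          also have "\<dots> = 0" using xy norm_on_zero[OF M V] by (simp add: linear_diff[OF T(1)])
          finally show "x = y" by (simp add: divide_le_0_iff pos3)
        qed
        from linear_exists_left_inverse_on[OF T(1) V this] that show thesis by blast
      qed
      have SV: "S ` ?V = ?V" using S(2) by (subst (1) T(2)[symmetric]) (auto simp: image_image)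
      have MS: "M' (S x) = M x" if "x \<in> ?V" for x
      proof -
        have "x \<in> T ` ?V" using that by (simp add: T(2))
        then obtain y where y: "y \<in> ?V" "x = T y" by blast
        then show ?thesis using S(2) by (simp add: M'_def)
      qed
      have "?\<Pi> M \<le> 1 * 1 * ?\<Pi> M'"
        by (rule proj_const_compare[OF M M' S(1) SV]) (simp_all add: MS)
      then show ?thesis by simp
    qed
    ultimately show ?thesis by blast
  qed
  have "?K \<noteq> {}" using equiv[OF norm_on_norm] by blast
  then obtain N where N: "N \<in> ?K" "\<And>M. M \<in> ?K \<Longrightarrow> ?\<Pi> M \<le> ?\<Pi> N"
    using continuous_attains_sup[OF compact_pinched_norms[of ?a n ?b] _ continuous_on_proj_const[of ?a ?b n]]
    by force
  have nN: "norm_on ?V N" using N(1) by (simp add: pinched_norms_def)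
  have max: "?\<Pi> M \<le> ?\<Pi> N" if M: "norm_on ?V M" for M
  proof -
    obtain M' where "M' \<in> ?K" "?\<Pi> M \<le> ?\<Pi> M'" using equiv[OF M] by blast
    then show ?thesis using N(2)[of M'] by simp
  qed
  have "max_proj_const n = ?\<Pi> N"
    unfolding max_proj_const_def by (rule Greatest_equality) (use nN max in auto)
  then show thesis using that[OF nN] max by simp
qed

section \<open>Subspaces of codimension n have small projections\<close>

lemma isometric_embedding_sum:
  assumes "isometric_embedding V N j" "subspace V" "\<And>a. a \<in> A \<Longrightarrow> v a \<in> V"
  shows "j (\<Sum>a\<in>A. c a *\<^sub>R v a) = (\<Sum>a\<in>A. c a *\<^sub>R j (v a))"
  using assms(3)
proof (induction A rule: infinite_finite_induct)
  case (insert a A)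
  have "j (c a *\<^sub>R v a + (\<Sum>a\<in>A. c a *\<^sub>R v a)) = j (c a *\<^sub>R v a) + j (\<Sum>a\<in>A. c a *\<^sub>R v a)"
    using insert assms(2) by (intro isometric_embedding_add[OF assms(1)] subspace_sum subspace_scale) auto
  with insert show ?case by (simp add: isometric_embedding_scale[OF assms(1)])
qed (use isometric_embedding_scale[OF assms(1) subspace_0[OF assms(2)], of 0] in simp_all)

text \<open>The functionals \<open>A k\<close> are the coordinate functionals of the vectors \<open>z k\<close> that complete a basis
  of \<open>E\<close> to a basis of the coordinate space.\<close>

lemma codim_functionals:
  assumes E: "subspace E" "E \<subseteq> coord_space d" "dim E = d - n" and nd: "n \<le> d"
  obtains A z where "\<And>k. k < n \<Longrightarrow> z k \<in> coord_space d"
    "\<And>k l. k < n \<Longrightarrow> l < n \<Longrightarrow> (\<Sum>a<d. A k a * apply_bcontfun (z l) a) = (if k = l then 1 else 0)"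
    "E = {x \<in> coord_space d. \<forall>k<n. (\<Sum>a<d. A k a * apply_bcontfun x a) = 0}"
proof -
  let ?V = "coord_space d"
  obtain B where B: "B \<subseteq> E" "independent B" "E \<subseteq> span B" "card B = dim E"
    using basis_exists[of E] by blast
  have spanB: "span B = E" using B span_minimal[OF B(1) E(1)] by blast
  obtain B' where B': "B \<subseteq> B'" "B' \<subseteq> ?V" "independent B'" "?V \<subseteq> span B'"
    using maximal_independent_subset_extend[of B ?V] B(1,2) E(2) by blast
  have fin: "finite B'" using independent_coord_space_bound[OF B'(3,2)] by simp
  have "card B' = d" using dim_unique[OF B'(2,4,3) refl] by (simp add: dim_coord_space)
  then have "card (B' - B) = n"
    using card_Diff_subset[OF finite_subset[OF B'(1) fin] B'(1)] B(4) E(3) nd by simp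
  then obtain z where z: "bij_betw z {..<n} (B' - B)"
    using ex_bij_betw_nat_finite[of "B' - B"] fin by (auto simp: atLeast0LessThan)
  have zB: "z k \<in> B'" "z k \<notin> B" if "k < n" for k using bij_betw_apply[OF z, of k] that by auto
  have "\<exists>g. linear g \<and> (\<forall>x\<in>B'. g x = (if x = z k then 1 else 0 :: real))" for k
    by (rule linear_independent_extend[OF B'(3)])
  then obtain g where g: "\<And>k. linear (g k)" "\<And>k x. x \<in> B' \<Longrightarrow> g k x = (if x = z k then 1 else 0 :: real)"
    by metis
  define A where "A k a = g k (unit_vec a)" for k a
  have gA: "(\<Sum>a<d. A k a * apply_bcontfun x a) = g k x" if "x \<in> ?V" for k x
    using linear_coord_expansion[OF g(1) that] by (simp add: A_def mult.commute)
  show thesis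
  proof (rule that[of z A])
    show zV: "z k \<in> ?V" if "k < n" for k using zB[OF that] B'(2) by blast
    show "(\<Sum>a<d. A k a * apply_bcontfun (z l) a) = (if k = l then 1 else 0)" if "k < n" "l < n" for k l
      using gA[OF zV[OF that(2)]] g(2)[OF zB(1)[OF that(2)]] bij_betw_imp_inj_on[OF z] that
      by (auto simp: inj_on_def)
    show "E = {x \<in> ?V. \<forall>k<n. (\<Sum>a<d. A k a * apply_bcontfun x a) = 0}"
    proof (intro equalityI subsetI CollectI conjI allI impI)
      fix x k assume x: "x \<in> E" and k: "k < n"
      have "g k x = 0"
      proof (rule linear_eq_0_on_span[OF g(1)])
        show "x \<in> span B" using x spanB by simp
        show "g k b = 0" if "b \<in> B" for b using g(2)[of b k] that B'(1) zB(2)[OF k] by auto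
      qed
      then show "(\<Sum>a<d. A k a * apply_bcontfun x a) = 0" using gA x E(2) by auto
    next
      fix x assume x: "x \<in> {x \<in> ?V. \<forall>k<n. (\<Sum>a<d. A k a * apply_bcontfun x a) = 0}"
      then have "x \<in> span B'" using B'(4) by blast
      then obtain c where c: "x = (\<Sum>b\<in>B'. c b *\<^sub>R b)" using span_finite[OF fin] by auto
      have "c b = 0" if b: "b \<in> B' - B" for b
      proof -
        obtain k where k: "k < n" "b = z k" using bij_betw_imp_surj_on[OF z] b by auto
        have "0 = g k x" using x k gA[of x k] by simp
        also have "\<dots> = (\<Sum>v\<in>B'. c v * g k v)"
          by (simp add: c linear_sum[OF g(1)] linear_scale[OF g(1)])
        also have "\<dots> = (\<Sum>v\<in>B'. if v = b then c v else 0)"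
          by (intro sum.cong refl) (simp add: g(2) k(2))
        also have "\<dots> = c b" using fin b by simp
        finally show ?thesis by simp
      qed
      then have "x = (\<Sum>b\<in>B. c b *\<^sub>R b)"
        unfolding c by (intro sum.mono_neutral_right fin B') auto
      also have "\<dots> \<in> E" using B(1) by (intro subspace_sum subspace_scale E(1)) auto
      finally show "x \<in> E" .
    qed (use E in auto)
  qed
qed

text \<open>Conversely, a basis of the common kernel together with the vectors \<open>z k\<close> is a basis of the
  coordinate space.\<close>

lemma dim_of_functionals:
  assumes z: "\<And>k. k < n \<Longrightarrow> z k \<in> coord_space d"
    and Az: "\<And>k l. k < n \<Longrightarrow> l < n \<Longrightarrow> (\<Sum>a<d. A k a * apply_bcontfun (z l) a) = (if k = l then 1 else 0)"
    and E: "E = {x \<in> coord_space d. \<forall>k<n. (\<Sum>a<d. A k a * apply_bcontfun x a) = 0}"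
  shows "subspace E" "dim E = d - n"
proof -
  let ?V = "coord_space d"
  define \<phi> where "\<phi> k x = (\<Sum>a<d. A k a * apply_bcontfun x a)" for k x
  have \<phi>: "linear (\<phi> k)" for k
    by (rule linearI) (simp_all add: \<phi>_def sum.distrib sum_distrib_left algebra_simps)
  have \<phi>z: "\<phi> k (z l) = (if k = l then 1 else 0)" if "k < n" "l < n" for k l
    using Az[OF that] by (simp add: \<phi>_def)
  have E': "E = {x \<in> ?V. \<forall>k<n. \<phi> k x = 0}" by (simp add: E \<phi>_def)
  show sub: "subspace E"
    unfolding subspace_def E'
    by (auto simp: linear_add[OF \<phi>] linear_scale[OF \<phi>] linear_0[OF \<phi>]
        intro: subspace_add subspace_scale subspace_0 subspace_coord_space)
  obtain B where B: "B \<subseteq> E" "independent B" "E \<subseteq> span B" "card B = dim E"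
    using basis_exists[of E] by blast
  have BV: "B \<subseteq> ?V" using B(1) by (auto simp: E)
  have fin: "finite B" using independent_coord_space_bound[OF B(2) BV] by simp
  have inj: "inj_on z {..<n}"
  proof (rule inj_onI)
    fix k l assume kl: "k \<in> {..<n}" "l \<in> {..<n}" "z k = z l"
    then have "\<phi> k (z k) = \<phi> k (z l)" by simp
    then show "k = l" using kl \<phi>z[of k k] \<phi>z[of k l] by (simp split: if_splits)
  qed
  have disj: "B \<inter> z ` {..<n} = {}"
  proof (rule ccontr)
    assume "\<not> ?thesis"
    then obtain k where k: "k < n" "z k \<in> B" by auto
    then have "\<phi> k (z k) = 0" using B(1) by (auto simp: E')
    then show False using \<phi>z k by simp
  qed
  let ?B = "B \<union> z ` {..<n}"
  have split: "(\<Sum>v\<in>?B. f v *\<^sub>R v) = (\<Sum>v\<in>B. f v *\<^sub>R v) + (\<Sum>l<n. f (z l) *\<^sub>R z l)" for f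
    using fin disj by (subst sum.union_disjoint) (auto simp: sum.reindex[OF inj])
  have "independent ?B"
  proof (rule independent_if_scalars_zero)
    fix f x assume s: "(\<Sum>v\<in>?B. f v *\<^sub>R v) = 0" and x: "x \<in> ?B"
    have fz: "f (z k) = 0" if k: "k < n" for k
    proof -
      have "0 = \<phi> k ((\<Sum>v\<in>B. f v *\<^sub>R v) + (\<Sum>l<n. f (z l) *\<^sub>R z l))"
        using s unfolding split by (simp add: linear_0[OF \<phi>])
      also have "\<dots> = (\<Sum>v\<in>B. f v * \<phi> k v) + (\<Sum>l<n. f (z l) * \<phi> k (z l))"
        by (simp add: linear_add[OF \<phi>] linear_sum[OF \<phi>] linear_scale[OF \<phi>])
      also have "(\<Sum>v\<in>B. f v * \<phi> k v) = 0"
        using B(1) k by (intro sum.neutral) (auto simp: E')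
      also have "(\<Sum>l<n. f (z l) * \<phi> k (z l)) = (\<Sum>l<n. if k = l then f (z l) else 0)"
        by (intro sum.cong refl) (simp add: \<phi>z k)
      also have "0 + \<dots> = f (z k)" using k by simp
      finally show ?thesis by simp
    qed
    then have "(\<Sum>v\<in>B. f v *\<^sub>R v) = 0" using s unfolding split by simp
    then have "f v = 0" if "v \<in> B" for v using independentD[OF B(2) fin order_refl] that by blast
    with fz x show "f x = 0" by auto
  qed (use fin in simp)
  moreover have "?B \<subseteq> ?V" using BV z by auto
  moreover have "?V \<subseteq> span ?B"
  proof
    fix x assume x: "x \<in> ?V"
    define y where "y = (\<Sum>l<n. \<phi> l x *\<^sub>R z l)"
    have y: "y \<in> span ?B" unfolding y_def by (intro span_sum span_scale span_base) auto
    have "\<phi> k y = \<phi> k x" if k: "k < n" for k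
    proof -
      have "\<phi> k y = (\<Sum>l<n. if k = l then \<phi> l x else 0)"
        unfolding y_def linear_sum[OF \<phi>] linear_scale[OF \<phi>]
        by (intro sum.cong refl) (simp add: \<phi>z k)
      then show ?thesis using k by simp
    qed
    moreover have "y \<in> ?V"
      unfolding y_def using z by (intro subspace_sum subspace_scale subspace_coord_space) auto
    ultimately have "x - y \<in> E"
      using x subspace_diff[OF subspace_coord_space x] by (simp add: E' linear_diff[OF \<phi>])
    then have "x - y \<in> span ?B" using B(3) span_mono[of B ?B] by blast
    from span_add[OF this y] show "x \<in> span ?B" by simp
  qed
  ultimately have "card ?B = d" using dim_unique[of ?B ?V] by (simp add: dim_coord_space)
  moreover have "card ?B = dim E + n"
    using fin disj B(4) by (subst card_Un_disjoint) (auto simp: card_image[OF inj])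
  ultimately show "dim E = d - n" by simp
qed

lemma sum_abs_norm_on:
  fixes d :: nat
  assumes "\<And>u. u \<in> coord_space n \<Longrightarrow> (\<And>a. a < d \<Longrightarrow> \<phi> u a = 0) \<Longrightarrow> u = 0"
    and "\<And>a. linear (\<lambda>u::linf. \<phi> u a)"
  shows "norm_on (coord_space n) (\<lambda>u. \<Sum>a<d. \<bar>\<phi> u a :: real\<bar>)"
  unfolding norm_on_def
proof (intro conjI ballI allI)
  fix u assume u: "u \<in> coord_space n"
  show "0 \<le> (\<Sum>a<d. \<bar>\<phi> u a\<bar>)" by (simp add: sum_nonneg)
  show "(\<Sum>a<d. \<bar>\<phi> u a\<bar>) = 0 \<longleftrightarrow> u = 0"
    using assms(1)[OF u] linear_0[OF assms(2)] by (subst sum_nonneg_eq_0_iff) auto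
  show "(\<Sum>a<d. \<bar>\<phi> (c *\<^sub>R u) a\<bar>) = \<bar>c\<bar> * (\<Sum>a<d. \<bar>\<phi> u a\<bar>)" for c
    by (simp add: linear_scale[OF assms(2)] abs_mult sum_distrib_left)
  fix v
  show "(\<Sum>a<d. \<bar>\<phi> (u + v) a\<bar>) \<le> (\<Sum>a<d. \<bar>\<phi> u a\<bar>) + (\<Sum>a<d. \<bar>\<phi> v a\<bar>)"
    by (simp add: linear_add[OF assms(2)] sum_mono flip: sum.distrib)
qed

text \<open>The annihilator of \<open>E\<close> in \<open>\<ell>\<^sub>1\<^sup>d\<close> has dimension \<open>n\<close>, so it sits in the bounded sequences with a
  projection of norm at most \<open>max_proj_const n + e\<close>. Extending this embedding to \<open>\<ell>\<^sub>1\<^sup>d\<close> with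
  norm \<open>1\<close>, which injectivity allows, yields a projection of \<open>\<ell>\<^sub>1\<^sup>d\<close> onto the annihilator with the
  same bound. Its transpose acts on \<open>\<ell>\<^sub>\<infinity>\<^sup>d\<close> with the same norm and has the kernel \<open>E\<close>, and
  the complement of the transpose is the required projection.\<close>

theorem small_projection_codim:
  assumes E: "subspace E" "E \<subseteq> coord_space d" "dim E = d - n" and nd: "n \<le> d" and e: "0 < e"
  obtains R where "projection_onto E R" "onorm R \<le> 1 + max_proj_const n + e"
proof -
  let ?V = "coord_space n"
  note V = subspace_coord_space[of n]
  obtain A z where z: "\<And>k. k < n \<Longrightarrow> z k \<in> coord_space d"
    and Az: "\<And>k l. k < n \<Longrightarrow> l < n \<Longrightarrow> (\<Sum>a<d. A k a * apply_bcontfun (z l) a) = (if k = l then 1 else 0)"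
    and E_eq: "E = {x \<in> coord_space d. \<forall>k<n. (\<Sum>a<d. A k a * apply_bcontfun x a) = 0}"
    using codim_functionals[OF E nd] by blast
  \<comment> \<open>The vectors \<open>\<phi> u\<close> form the annihilator of \<open>E\<close>, and \<open>N\<close> is its \<open>\<ell>\<^sub>1\<close> norm.\<close>
  define \<phi> where "\<phi> u a = (\<Sum>k<n. apply_bcontfun u k * A k a)" for u a
  define N where "N u = (\<Sum>a<d. \<bar>\<phi> u a\<bar>)" for u
  have \<phi>: "linear (\<lambda>u. \<phi> u a)" for a
    by (rule linearI) (simp_all add: \<phi>_def sum.distrib sum_distrib_left algebra_simps)
  have pair: "(\<Sum>a<d. \<phi> u a * y a) = (\<Sum>k<n. apply_bcontfun u k * (\<Sum>a<d. A k a * y a))" for u y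
    unfolding \<phi>_def sum_distrib_right sum_distrib_left
    by (subst sum.swap) (simp add: mult.assoc)
  have \<phi>z: "(\<Sum>a<d. \<phi> u a * apply_bcontfun (z l) a) = apply_bcontfun u l" if l: "l < n" for u l
  proof -
    have "(\<Sum>a<d. \<phi> u a * apply_bcontfun (z l) a) = (\<Sum>k<n. if k = l then apply_bcontfun u k else 0)"
      unfolding pair by (intro sum.cong refl) (simp add: Az l)
    then show ?thesis using l by simp
  qed
  have N: "norm_on ?V N"
    unfolding N_def
  proof (rule sum_abs_norm_on[OF _ \<phi>])
    fix u assume u: "u \<in> ?V" and 0: "\<And>a. a < d \<Longrightarrow> \<phi> u a = 0"
    show "u = 0"
    proof (rule bcontfun_eqI)
      fix i show "apply_bcontfun u i = apply_bcontfun 0 i"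
        using \<phi>z[of i u] 0 coord_space_apply[OF u, of i] by (cases "i < n") simp_all
    qed
  qed
  obtain j where j: "isometric_embedding ?V N j" by (rule isometric_embedding_exists[OF N])
  have "proj_const ?V N \<le> max_proj_const n" using max_proj_const_attained[of n] N by metis
  then have "proj_const ?V N < max_proj_const n + e" using e by simp
  then obtain P where P: "projection_onto (j ` ?V) P" "onorm P < max_proj_const n + e"
    by (rule proj_const_coord_space_less[OF N j])
  have blP: "bounded_linear P" using P(1) by (simp add: projection_onto_def)
  have linP: "linear P" by (rule bounded_linear.linear[OF blP])
  define Y where "Y = (\<lambda>u. coord_vec d (\<phi> u)) ` ?V"
  \<comment> \<open>The inverse of \<open>\<phi>\<close> on the annihilator, given by the dual vectors \<open>z\<close>.\<close>
  define coeffs where "coeffs y = coord_vec n (\<lambda>k. \<Sum>a<d. apply_bcontfun y a * apply_bcontfun (z k) a)" for y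
  have coeffs_lin: "linear coeffs"
    by (rule linearI; rule bcontfun_eqI)
      (simp_all add: coeffs_def coord_vec_apply sum.distrib sum_distrib_left algebra_simps)
  have coeffsV: "coeffs y \<in> ?V" for y by (simp add: coeffs_def coord_vec_in)
  have coeffs: "coeffs (coord_vec d (\<phi> u)) = u" if "u \<in> ?V" for u
    by (rule bcontfun_eqI) (auto simp: coeffs_def coord_vec_apply \<phi>z coord_space_apply[OF that])
  have lin\<phi>: "linear (\<lambda>u. coord_vec d (\<phi> u))"
    by (rule linearI; rule bcontfun_eqI) (simp_all add: coord_vec_apply linear_add[OF \<phi>] linear_scale[OF \<phi>])
  have l1: "sublinear (\<lambda>y::linf. \<Sum>a<d. \<bar>apply_bcontfun y a\<bar>)"
    unfolding sublinear_def by (auto simp: abs_mult sum_distrib_left simp flip: sum.distrib intro: sum_mono)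
  obtain S where S: "linear S" "\<And>y. y \<in> Y \<Longrightarrow> S y = j (coeffs y)"
    "\<And>y. norm (S y) \<le> (\<Sum>a<d. \<bar>apply_bcontfun y a\<bar>)"
  proof (rule linf_injective[OF l1])
    show "subspace Y" unfolding Y_def by (rule linear_subspace_image[OF lin\<phi> V])
    fix y assume "y \<in> Y"
    then obtain u where u: "u \<in> ?V" "y = coord_vec d (\<phi> u)" by (auto simp: Y_def)
    then show "norm (j (coeffs y)) \<le> (\<Sum>a<d. \<bar>apply_bcontfun y a\<bar>)"
      by (simp add: coeffs isometric_embedding_norm[OF j] N_def coord_vec_apply)
  qed (simp_all add: linear_add[OF coeffs_lin] linear_scale[OF coeffs_lin] coeffsV
      isometric_embedding_add[OF j] isometric_embedding_scale[OF j])
  have S\<phi>: "(\<Sum>a<d. \<phi> u a *\<^sub>R S (unit_vec a)) = j u" if "u \<in> ?V" for u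
  proof -
    have "S (coord_vec d (\<phi> u)) = j u" using S(2) that by (simp add: Y_def coeffs)
    then show ?thesis by (simp add: coord_vec_eq_sum linear_sum[OF S(1)] linear_scale[OF S(1)])
  qed
  have "\<exists>v\<in>?V. j v = P (S (unit_vec a))" for a
    using projection_in[OF P(1), of "S (unit_vec a)"] by auto
  then obtain v where v: "\<And>a. v a \<in> ?V" "\<And>a. j (v a) = P (S (unit_vec a))" by metis
  \<comment> \<open>The map that sends the \<open>a\<close>-th unit vector to \<open>\<phi> (v a)\<close> is the projection of \<open>\<ell>\<^sub>1\<^sup>d\<close>.\<close>
  have recon: "(\<Sum>a<d. \<phi> u a *\<^sub>R v a) = u" if u: "u \<in> ?V" for u
  proof -
    have "j (\<Sum>a<d. \<phi> u a *\<^sub>R v a) = (\<Sum>a<d. \<phi> u a *\<^sub>R P (S (unit_vec a)))"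
      by (subst isometric_embedding_sum[OF j V]) (simp_all add: v)
    also have "\<dots> = P (j u)" by (simp add: linear_sum[OF linP] linear_scale[OF linP] flip: S\<phi>[OF u])
    also have "\<dots> = j u" using u by (intro projection_fixes[OF P(1)]) simp
    finally show ?thesis
      using isometric_embedding_inj[OF N j V] u v(1)
      by (auto simp: inj_on_def intro: subspace_sum subspace_scale V)
  qed
  have row: "N (v a) \<le> onorm P" if "a < d" for a
  proof -
    have "norm (S (unit_vec a)) \<le> (\<Sum>b<d. if b = a then 1 else 0)"
      using S(3)[of "unit_vec a"] by (simp add: unit_vec_apply if_distrib cong: if_cong)
    also have "\<dots> \<le> 1" using that by simp
    finally have "norm (S (unit_vec a)) \<le> 1" .
    then have "onorm P * norm (S (unit_vec a)) \<le> onorm P * 1"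
      by (intro mult_left_mono onorm_pos_le blP)
    moreover have "N (v a) = norm (P (S (unit_vec a)))"
      using isometric_embedding_norm[OF j v(1), of a] by (simp add: v(2))
    ultimately show ?thesis using onorm[OF blP, of "S (unit_vec a)"] by simp
  qed
  \<comment> \<open>The identity minus the transposed projection.\<close>
  define R where
    "R x = coord_vec d (\<lambda>a. apply_bcontfun x a - (\<Sum>b<d. \<phi> (v a) b * apply_bcontfun x b))" for x
  have linR: "linear R"
    by (rule linearI; rule bcontfun_eqI)
      (simp_all add: R_def coord_vec_apply sum.distrib sum_distrib_left algebra_simps)
  have bnd: "norm (R x) \<le> (1 + onorm P) * norm x" for x
  proof (rule norm_linf_le)
    fix i
    show "\<bar>apply_bcontfun (R x) i\<bar> \<le> (1 + onorm P) * norm x"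
    proof (cases "i < d")
      case True
      have "\<bar>\<Sum>b<d. \<phi> (v i) b * apply_bcontfun x b\<bar> \<le> (\<Sum>b<d. \<bar>\<phi> (v i) b\<bar> * norm x)"
        by (auto simp: abs_mult intro!: order_trans[OF sum_abs] sum_mono mult_left_mono abs_apply_le_norm)
      also have "\<dots> = N (v i) * norm x" by (simp add: N_def sum_distrib_right)
      also have "\<dots> \<le> onorm P * norm x" using row[OF True] by (intro mult_right_mono) auto
      finally show ?thesis
        using True abs_apply_le_norm[of x i] by (simp add: R_def coord_vec_apply distrib_right)
    qed (simp add: R_def coord_vec_apply onorm_pos_le blP)
  qed
  have "projection_onto E R"
  proof (rule projection_ontoI[OF linR])
    show "norm (R x) \<le> norm x * (1 + onorm P)" for x using bnd[of x] by (simp add: mult.commute)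
    show "R x \<in> E" for x
      unfolding E_eq
    proof (intro CollectI conjI allI impI)
      show "R x \<in> coord_space d" by (simp add: R_def coord_vec_in)
      fix k assume k: "k < n"
      have \<phi>k: "\<phi> (unit_vec k) a = A k a" for a
        using k by (simp add: \<phi>_def unit_vec_apply if_distrib[of "\<lambda>t. t * _"] cong: if_cong)
      have *: "(\<Sum>a<d. A k a * \<phi> (v a) b) = A k b" for b
      proof -
        have "(\<Sum>a<d. A k a * \<phi> (v a) b) = \<phi> (\<Sum>a<d. \<phi> (unit_vec k) a *\<^sub>R v a) b"
          by (simp add: linear_sum[OF \<phi>] linear_scale[OF \<phi>] \<phi>k)
        then show ?thesis using recon[OF unit_vec_in[OF k]] \<phi>k by simp
      qed
      have "(\<Sum>a<d. A k a * (\<Sum>b<d. \<phi> (v a) b * apply_bcontfun x b))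
          = (\<Sum>b<d. (\<Sum>a<d. A k a * \<phi> (v a) b) * apply_bcontfun x b)"
        unfolding sum_distrib_right sum_distrib_left by (subst sum.swap) (simp add: mult.assoc)
      then show "(\<Sum>a<d. A k a * apply_bcontfun (R x) a) = 0"
        by (simp add: R_def coord_vec_apply right_diff_distrib sum_subtractf *)
    qed
    fix x assume x: "x \<in> E"
    have "(\<Sum>b<d. \<phi> u b * apply_bcontfun x b) = 0" for u
      unfolding pair using x by (simp add: E_eq)
    then show "R x = x" using x by (simp add: R_def E_eq coord_vec_self)
  qed
  moreover have "onorm R \<le> 1 + onorm P" by (rule onorm_bound[OF _ bnd]) (simp add: onorm_pos_le blP)
  ultimately show thesis using P(2) by (intro that[of R]) auto
qed

lemma proj_const_le_codim:
  assumes E: "subspace E" "E \<subseteq> coord_space d" "dim E = d - n" and nd: "n \<le> d"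
  shows "proj_const E norm \<le> 1 + max_proj_const n"
proof (rule field_le_epsilon)
  fix e :: real assume "0 < e"
  then obtain R where R: "projection_onto E R" "onorm R \<le> 1 + max_proj_const n + e"
    by (rule small_projection_codim[OF E nd])
  have "proj_const E norm \<le> onorm R"
    by (rule proj_const_le[OF E(1) norm_on_norm isometric_embedding_inclusion]) (simp add: R(1))
  with R(2) show "proj_const E norm \<le> 1 + max_proj_const n + e" by simp
qed

section \<open>Averaging weights and their discretisation\<close>

text \<open>A minimax theorem of Ville's type: if the maximum over \<open>i\<close> of the convex functions \<open>r v i\<close> is
  at least \<open>c\<close> for every \<open>v\<close>, one weighted average works for all \<open>v\<close>. Consider the sublinear
  functional \<open>y \<mapsto> (INF s\<ge>0, v\<in>K. MAX i<d. y i + s (r v i - c))\<close>. It is at most the maximum of \<open>y\<close>,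
  so every linear functional below it is a weighted average, and at the vector \<open>c - r v\<close> it is at
  most \<open>0\<close>, as \<open>s = 1\<close> shows.\<close>

lemma minimax_weights:
  fixes r :: "'v \<Rightarrow> nat \<Rightarrow> real"
  assumes ne: "K \<noteq> {}"
    and conv: "\<And>v v' t. v \<in> K \<Longrightarrow> v' \<in> K \<Longrightarrow> 0 \<le> t \<Longrightarrow> t \<le> 1 \<Longrightarrow>
      \<exists>v''\<in>K. \<forall>i<d. r v'' i \<le> t * r v i + (1 - t) * r v' i"
    and c: "\<And>v. v \<in> K \<Longrightarrow> \<exists>i<d. c \<le> r v i"
  obtains w where "\<And>i. i < d \<Longrightarrow> 0 \<le> w i" "(\<Sum>i<d. w i) = 1"
    "\<And>v. v \<in> K \<Longrightarrow> c \<le> (\<Sum>i<d. w i * r v i)"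
proof -
  define C where "C = {(y :: linf, b). \<exists>s\<ge>0. \<exists>v\<in>K. \<forall>i<d. apply_bcontfun y i + s * (r v i - c) \<le> b}"
  have CI: "(y, b) \<in> C" if "0 \<le> s" "v \<in> K" "\<And>i. i < d \<Longrightarrow> apply_bcontfun y i + s * (r v i - c) \<le> b" for y b s v
    using that unfolding C_def by blast
  obtain v0 where v0: "v0 \<in> K" using ne by blast
  have C0: "(y, b) \<in> C" if "\<And>i. i < d \<Longrightarrow> apply_bcontfun y i \<le> b" for y b
    by (rule CI[of 0 v0]) (simp_all add: v0 that)
  obtain p where p: "sublinear p" "\<And>y b. (y, b) \<in> C \<Longrightarrow> p y \<le> b"
  proof (rule cone_lower_envelope[of C])
    fix y b y' b' assume "(y, b) \<in> C" "(y', b') \<in> C"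
    then obtain s v s' v' where s: "0 \<le> s" "v \<in> K" "\<And>i. i < d \<Longrightarrow> apply_bcontfun y i + s * (r v i - c) \<le> b"
      and s': "0 \<le> s'" "v' \<in> K" "\<And>i. i < d \<Longrightarrow> apply_bcontfun y' i + s' * (r v' i - c) \<le> b'"
      unfolding C_def by blast
    show "(y + y', b + b') \<in> C"
    proof (cases "s + s' = 0")
      case True
      then have "s = 0" "s' = 0" using s s' by auto
      then show ?thesis using s(3) s'(3) by (intro C0) (auto intro: add_mono)
    next
      case False
      then have pos: "0 < s + s'" using s s' by auto
      define t where "t = s / (s + s')"
      have t: "0 \<le> t" "t \<le> 1" "(s + s') * t = s" "(s + s') * (1 - t) = s'"
        using pos s s' by (auto simp: t_def field_simps)
      obtain v'' where v'': "v'' \<in> K" "\<And>i. i < d \<Longrightarrow> r v'' i \<le> t * r v i + (1 - t) * r v' i"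
        using conv[OF s(2) s'(2) t(1,2)] by blast
      show ?thesis
      proof (rule CI[of "s + s'" v''])
        fix i assume i: "i < d"
        have "(s + s') * r v'' i \<le> (s + s') * (t * r v i + (1 - t) * r v' i)"
          using v''(2)[OF i] pos by (intro mult_left_mono) auto
        also have "\<dots> = ((s + s') * t) * r v i + ((s + s') * (1 - t)) * r v' i" by (simp add: algebra_simps)
        also have "\<dots> = s * r v i + s' * r v' i" by (simp only: t)
        finally show "apply_bcontfun (y + y') i + (s + s') * (r v'' i - c) \<le> b + b'"
          using s(3)[OF i] s'(3)[OF i] by (simp add: algebra_simps)
      qed (use pos v'' in auto)
    qed
  next
    fix k :: real and y b assume k: "0 < k" and "(y, b) \<in> C"
    then obtain s v where s: "0 \<le> s" "v \<in> K" "\<And>i. i < d \<Longrightarrow> apply_bcontfun y i + s * (r v i - c) \<le> b"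
      unfolding C_def by blast
    show "(k *\<^sub>R y, k * b) \<in> C"
    proof (rule CI[of "k * s" v])
      fix i assume "i < d"
      from mult_left_mono[OF s(3)[OF this], of k] k
      show "apply_bcontfun (k *\<^sub>R y) i + k * s * (r v i - c) \<le> k * b" by (simp add: algebra_simps)
    qed (use k s in auto)
  next
    show "(0, 0) \<in> C" by (rule C0) simp
  next
    fix b assume "((0 :: linf), b) \<in> C"
    then obtain s v where s: "0 \<le> s" "v \<in> K" "\<And>i. i < d \<Longrightarrow> s * (r v i - c) \<le> b"
      unfolding C_def by auto
    obtain i where "i < d" "c \<le> r v i" using c[OF s(2)] by blast
    then have "0 \<le> s * (r v i - c)" using s(1) by simp
    then show "0 \<le> b" using s(3)[OF \<open>i < d\<close>] by linarith
  next
    fix y :: linf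
    have "(y, norm y) \<in> C" by (rule C0) (use abs_apply_le_norm abs_le_D1 in blast)
    then show "\<exists>b. (y, b) \<in> C" by blast
  qed (rule that)
  obtain g where g: "linear g" "\<And>y. g y \<le> p y" using linear_below_sublinear[OF p(1)] by blast
  have gC: "g y \<le> b" if "(y, b) \<in> C" for y b using g(2)[of y] p(2)[OF that] by simp
  have g_vec: "g (coord_vec d h) = (\<Sum>i<d. g (unit_vec i) * h i)" for h
    by (simp add: coord_vec_eq_sum linear_sum[OF g(1)] linear_scale[OF g(1)] mult.commute)
  show thesis
  proof (rule that[of "\<lambda>i. g (unit_vec i)"])
    show "0 \<le> g (unit_vec i)" if "i < d" for i
      using gC[OF C0[of "- unit_vec i" 0]] by (simp add: unit_vec_apply linear_neg[OF g(1)])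
    have "g (coord_vec d (\<lambda>_. 1)) \<le> 1" by (intro gC C0) (simp add: coord_vec_apply)
    moreover have "g (coord_vec d (\<lambda>_. - 1)) \<le> - 1" by (intro gC C0) (simp add: coord_vec_apply)
    ultimately show one: "(\<Sum>i<d. g (unit_vec i)) = 1" by (simp add: g_vec sum_negf)
    fix v assume v: "v \<in> K"
    have "g (coord_vec d (\<lambda>i. c - r v i)) \<le> 0"
      by (intro gC CI[of 1 v]) (simp_all add: v coord_vec_apply)
    then have "(\<Sum>i<d. g (unit_vec i)) * c \<le> (\<Sum>i<d. g (unit_vec i) * r v i)"
      by (simp add: g_vec right_diff_distrib sum_subtractf sum_distrib_right)
    then show "c \<le> (\<Sum>i<d. g (unit_vec i) * r v i)" by (simp add: one)
  qed
qed

lemma map_with_fibre_sizes: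
  "\<exists>\<iota>::nat \<Rightarrow> nat. (\<forall>a<(\<Sum>i<d. m i). \<iota> a < d) \<and> (\<forall>i<d. card {a. a < (\<Sum>i<d. m i) \<and> \<iota> a = i} = m i)"
proof (induction d)
  case (Suc d)
  let ?s = "\<Sum>i<d. m i"
  obtain \<iota> :: "nat \<Rightarrow> nat" where \<iota>: "\<And>a. a < ?s \<Longrightarrow> \<iota> a < d" "\<And>i. i < d \<Longrightarrow> card {a. a < ?s \<and> \<iota> a = i} = m i"
    using Suc by blast
  let ?\<iota> = "\<lambda>a. if a < ?s then \<iota> a else d"
  have "card {a. a < ?s + m d \<and> ?\<iota> a = i} = m i" if i: "i < Suc d" for i
  proof (cases "i = d")
    case True
    have "{a. a < ?s + m d \<and> ?\<iota> a = i} = {?s..<?s + m d}"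
      using \<iota>(1) True by (fastforce split: if_splits)
    then show ?thesis using True by simp
  next
    case False
    then have "{a. a < ?s + m d \<and> ?\<iota> a = i} = {a. a < ?s \<and> \<iota> a = i}" by auto
    then show ?thesis using \<iota>(2) i False by simp
  qed
  then show ?case using \<iota>(1) by (intro exI[of _ ?\<iota>]) (auto simp: less_Suc_eq)
qed simp

text \<open>Weights are approximated by multiplicities that add up to \<open>D\<close>: every index receives \<open>q\<close> copies in
  advance, and the remaining \<open>D - d q\<close> are distributed according to the weights. Rounding down is
  harmless because one of the advance copies makes up for it, and what is left over goes to the
  index \<open>0\<close>.\<close>

lemma integer_multiplicities:
  fixes w :: "nat \<Rightarrow> real"
  assumes w: "\<And>i. i < d \<Longrightarrow> 0 \<le> w i" "(\<Sum>i<d. w i) = 1" and q: "1 \<le> q" and D: "d * q \<le> D"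
  obtains m where "(\<Sum>i<d. m i) = D" "\<And>i. i < d \<Longrightarrow> q \<le> m i"
    "\<And>i. i < d \<Longrightarrow> (real D - real d * real q) * w i \<le> real (m i)"
proof -
  define M where "M = real D - real d * real q"
  have M: "0 \<le> M" using D unfolding M_def by (simp flip: of_nat_mult)
  define m' where "m' i = nat \<lfloor>M * w i\<rfloor> + q" for i
  have up: "real (m' i) \<le> M * w i + real q" if "i < d" for i
    unfolding m'_def using M w(1)[OF that] by simp
  have lo: "M * w i \<le> real (m' i)" if "i < d" for i
  proof -
    have "M * w i \<le> real (nat \<lfloor>M * w i\<rfloor>) + 1" using M w(1)[OF that] by simp
    then show ?thesis using q by (simp add: m'_def)
  qed
  have d: "0 < d" using w(2) by (cases d) auto
  have "real (\<Sum>i<d. m' i) \<le> (\<Sum>i<d. M * w i + real q)" unfolding of_nat_sum by (intro sum_mono up) simp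
  also have "\<dots> = M * (\<Sum>i<d. w i) + real d * real q" by (simp add: sum.distrib sum_distrib_left)
  also have "\<dots> = real D" by (simp add: w(2) M_def)
  finally have le: "(\<Sum>i<d. m' i) \<le> D" by linarith
  define m where "m i = m' i + (if i = 0 then D - (\<Sum>i<d. m' i) else 0)" for i
  show thesis
  proof (rule that[of m])
    show "(\<Sum>i<d. m i) = D" using le d by (simp add: m_def sum.distrib)
    show "q \<le> m i" if "i < d" for i by (simp add: m_def m'_def)
    show "(real D - real d * real q) * w i \<le> real (m i)" if "i < d" for i
      using lo[OF that] by (auto simp: m_def M_def)
  qed
qed

section \<open>Subspaces of codimension n without small projections\<close>

text \<open>These are the factorisations of the identity of the coordinate space through \<open>\<real>\<^sup>d\<close>: the map
  \<open>y \<mapsto> (\<Sum>i<d. y\<^sub>i v\<^sub>i)\<close> is a left inverse of \<open>u \<mapsto> (f\<^sub>i u)\<^sub>i\<close>. The other composition is a projection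
  of \<open>\<real>\<^sup>d\<close> with the matrix entries \<open>f\<^sub>i (v\<^sub>k)\<close>, whose norm on \<open>\<ell>\<^sub>\<infinity>\<^sup>d\<close> is the largest
  row sum of absolute values.\<close>

definition resolutions :: "nat \<Rightarrow> nat \<Rightarrow> (nat \<Rightarrow> linf \<Rightarrow> real) \<Rightarrow> (nat \<Rightarrow> linf) set" where
  "resolutions n d f = {v. (\<forall>i<d. v i \<in> coord_space n) \<and>
     (\<forall>u\<in>coord_space n. (\<Sum>i<d. f i u *\<^sub>R v i) = u)}"

text \<open>Here \<open>f i\<close> is the \<open>i\<close>-th coordinate of an isometric embedding, and \<open>d\<close> is so large that these
  coordinates norm the space up to the factor \<open>1 - e\<close>. A resolution with small row sums would give
  the projection \<open>y \<mapsto> j (\<Sum>k<d. y\<^sub>k v\<^sub>k)\<close> onto the embedded space, of norm less than the projection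
  constant.\<close>

lemma resolutions_of_norm:
  assumes N: "norm_on (coord_space n) N" and e: "0 < e" "e < 1"
  obtains d f where "\<And>i. linear (f i)" "resolutions n d f \<noteq> {}"
    "\<And>v. v \<in> resolutions n d f \<Longrightarrow> \<exists>i<d. (1 - e) * proj_const (coord_space n) N \<le> (\<Sum>k<d. \<bar>f i (v k)\<bar>)"
proof -
  let ?V = "coord_space n" and ?\<Pi> = "proj_const (coord_space n) N"
  note V = subspace_coord_space[of n]
  obtain j where j: "isometric_embedding ?V N j" by (rule isometric_embedding_exists[OF N])
  obtain d where d: "0 < d" "\<And>x. x \<in> ?V \<Longrightarrow> \<exists>i<d. (1 - e) * N x \<le> \<bar>apply_bcontfun (j x) i\<bar>"
    using finite_coordinates_almost_norming[OF N j e(1)] by blast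
  define f where "f i u = apply_bcontfun (j (coord_vec n (apply_bcontfun u))) i" for i u
  have f: "linear (f i)" for i
    by (rule linearI)
      (simp_all add: f_def linear_add[OF coord_vec_linear] linear_scale[OF coord_vec_linear] coord_vec_in
        isometric_embedding_add[OF j] isometric_embedding_scale[OF j] del: plus_bcontfun.rep_eq scaleR_bcontfun.rep_eq,
       simp_all)
  have fj: "f i u = apply_bcontfun (j u) i" if "u \<in> ?V" for i u by (simp add: f_def coord_vec_self that)
  have "resolutions n d f \<noteq> {}"
  proof -
    define L where "L u = coord_vec d (\<lambda>i. f i u)" for u
    have L: "linear L"
      by (rule linearI; rule bcontfun_eqI) (simp_all add: L_def coord_vec_apply linear_add[OF f] linear_scale[OF f])
    have "inj_on L ?V"
    proof (rule inj_onI)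
      fix x y assume xy: "x \<in> ?V" "y \<in> ?V" "L x = L y"
      have D: "x - y \<in> ?V" by (rule subspace_diff[OF V xy(1,2)])
      obtain i where i: "i < d" "(1 - e) * N (x - y) \<le> \<bar>f i (x - y)\<bar>" using d(2)[OF D] fj[OF D] by auto
      have "f i x = f i y" using arg_cong[OF xy(3), of "\<lambda>l. apply_bcontfun l i"] i(1) by (simp add: L_def coord_vec_apply)
      then have "(1 - e) * N (x - y) \<le> 0" using i(2) by (simp add: linear_diff[OF f])
      then have "N (x - y) \<le> 0" using e by (simp add: mult_le_0_iff)
      then have "N (x - y) = 0" using norm_on_nonneg[OF N D] by simp
      then show "x = y" using norm_on_eq_0[OF N D] by simp
    qed
    from linear_exists_left_inverse_on[OF L V this]
    obtain S where S: "range S \<subseteq> ?V" "linear S" "\<And>x. x \<in> ?V \<Longrightarrow> S (L x) = x" by blast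
    have "(\<Sum>i<d. f i u *\<^sub>R S (unit_vec i)) = u" if "u \<in> ?V" for u
      using S(3)[OF that] by (simp add: L_def coord_vec_eq_sum linear_sum[OF S(2)] linear_scale[OF S(2)])
    then have "(\<lambda>i. S (unit_vec i)) \<in> resolutions n d f" using S(1) by (auto simp: resolutions_def)
    then show ?thesis by blast
  qed
  moreover have "\<exists>i<d. (1 - e) * ?\<Pi> \<le> (\<Sum>k<d. \<bar>f i (v k)\<bar>)" if v: "v \<in> resolutions n d f" for v
  proof (rule ccontr)
    assume "\<not> ?thesis"
    then have less: "(\<Sum>k<d. \<bar>f i (v k)\<bar>) < (1 - e) * ?\<Pi>" if "i < d" for i using that by force
    have vV: "v k \<in> ?V" if "k < d" for k using v that by (simp add: resolutions_def)
    define \<rho> where "\<rho> = Max ((\<lambda>i. \<Sum>k<d. \<bar>f i (v k)\<bar>) ` {..<d})"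
    have \<rho>: "(\<Sum>k<d. \<bar>f i (v k)\<bar>) \<le> \<rho>" if "i < d" for i unfolding \<rho>_def using that by (intro Max_ge) auto
    have \<rho>less: "\<rho> < (1 - e) * ?\<Pi>" unfolding \<rho>_def using d(1) less by (subst Max_less_iff) auto
    have \<rho>0: "0 \<le> \<rho>" by (rule order_trans[OF sum_nonneg \<rho>[OF d(1)]]) simp
    define x where "x y = (\<Sum>k<d. apply_bcontfun y k *\<^sub>R v k)" for y :: linf
    have xV: "x y \<in> ?V" for y unfolding x_def using vV by (intro subspace_sum subspace_scale V) auto
    have x: "linear x"
      by (rule linearI) (simp_all add: x_def scaleR_add_left sum.distrib scaleR_sum_right)
    have bnd: "norm (j (x y)) \<le> (\<rho> / (1 - e)) * norm y" for y
    proof -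
      obtain i where i: "i < d" "(1 - e) * N (x y) \<le> \<bar>f i (x y)\<bar>" using d(2)[OF xV] fj[OF xV] by metis
      note i(2)
      also have "\<bar>f i (x y)\<bar> \<le> (\<Sum>k<d. norm y * \<bar>f i (v k)\<bar>)"
        by (auto simp: x_def linear_sum[OF f] linear_scale[OF f] abs_mult
            intro!: order_trans[OF sum_abs] sum_mono mult_right_mono abs_apply_le_norm)
      also have "\<dots> \<le> norm y * \<rho>" using \<rho>[OF i(1)] by (simp add: mult_left_mono flip: sum_distrib_left)
      finally show ?thesis
        using e isometric_embedding_norm[OF j xV, of y] by (simp add: field_simps)
    qed
    have "projection_onto (j ` ?V) (\<lambda>y. j (x y))"
    proof (rule projection_ontoI)
      show "linear (\<lambda>y. j (x y))"
        by (rule linearI)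
          (simp_all add: linear_add[OF x] linear_scale[OF x] xV isometric_embedding_add[OF j] isometric_embedding_scale[OF j])
      show "norm (j (x y)) \<le> norm y * (\<rho> / (1 - e))" for y using bnd[of y] by (simp add: mult.commute)
      show "j (x y) \<in> j ` ?V" for y using xV by blast
      fix y assume "y \<in> j ` ?V"
      then obtain u where u: "u \<in> ?V" "y = j u" by blast
      have "x y = (\<Sum>k<d. f k u *\<^sub>R v k)" by (simp add: x_def u fj)
      also have "\<dots> = u" using v u(1) by (simp add: resolutions_def)
      finally show "j (x y) = y" by (simp add: u)
    qed
    then have "?\<Pi> \<le> onorm (\<lambda>y. j (x y))" by (rule proj_const_le[OF V N j])
    also have "\<dots> \<le> \<rho> / (1 - e)" by (rule onorm_bound[OF _ bnd]) (use \<rho>0 e in simp)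
    finally show False using \<rho>less e by (simp add: field_simps)
  qed
  ultimately show thesis using f that by blast
qed

text \<open>Resolutions form a convex set and the row sums are convex on it, so the minimax theorem applies.\<close>

lemma resolution_weights:
  assumes f: "\<And>i. linear (f i)" and ne: "resolutions n d f \<noteq> {}"
    and c: "\<And>v. v \<in> resolutions n d f \<Longrightarrow> \<exists>i<d. c \<le> (\<Sum>k<d. \<bar>f i (v k)\<bar>)"
  obtains w where "\<And>i. i < d \<Longrightarrow> 0 \<le> w i" "(\<Sum>i<d. w i) = 1"
    "\<And>v. v \<in> resolutions n d f \<Longrightarrow> c \<le> (\<Sum>i<d. w i * (\<Sum>k<d. \<bar>f i (v k)\<bar>))"
proof (rule minimax_weights[OF ne _ c])
  fix v v' and t :: real
  assume v: "v \<in> resolutions n d f" "v' \<in> resolutions n d f" and t: "0 \<le> t" "t \<le> 1"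
  define v'' where "v'' k = t *\<^sub>R v k + (1 - t) *\<^sub>R v' k" for k
  have "(\<Sum>i<d. f i u *\<^sub>R v'' i) = u" if "u \<in> coord_space n" for u
  proof -
    have "(\<Sum>i<d. f i u *\<^sub>R v'' i) = t *\<^sub>R (\<Sum>i<d. f i u *\<^sub>R v i) + (1 - t) *\<^sub>R (\<Sum>i<d. f i u *\<^sub>R v' i)"
      by (simp add: v''_def scaleR_add_right sum.distrib scaleR_sum_right mult.commute)
    also have "\<dots> = t *\<^sub>R u + (1 - t) *\<^sub>R u" using v that by (simp add: resolutions_def)
    finally show ?thesis by (simp flip: scaleR_add_left)
  qed
  moreover have "v'' k \<in> coord_space n" if "k < d" for k
    unfolding v''_def using v that
    by (intro subspace_add subspace_scale subspace_coord_space) (auto simp: resolutions_def)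
  ultimately have "v'' \<in> resolutions n d f" by (simp add: resolutions_def)
  moreover have "(\<Sum>k<d. \<bar>f i (v'' k)\<bar>) \<le> t * (\<Sum>k<d. \<bar>f i (v k)\<bar>) + (1 - t) * (\<Sum>k<d. \<bar>f i (v' k)\<bar>)" for i
    unfolding sum_distrib_left sum.distrib[symmetric]
  proof (rule sum_mono)
    fix k
    show "\<bar>f i (v'' k)\<bar> \<le> t * \<bar>f i (v k)\<bar> + (1 - t) * \<bar>f i (v' k)\<bar>"
      using abs_triangle_ineq[of "t * f i (v k)" "(1 - t) * f i (v' k)"] t
      by (simp add: v''_def linear_add[OF f] linear_scale[OF f] abs_mult)
  qed
  ultimately show "\<exists>v''\<in>resolutions n d f. \<forall>i<d. (\<Sum>k<d. \<bar>f i (v'' k)\<bar>)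
      \<le> t * (\<Sum>k<d. \<bar>f i (v k)\<bar>) + (1 - t) * (\<Sum>k<d. \<bar>f i (v' k)\<bar>)" by blast
next
  fix w
  assume "\<And>i. i < d \<Longrightarrow> 0 \<le> w i" "(\<Sum>i<d. w i) = 1"
    "\<And>v. v \<in> resolutions n d f \<Longrightarrow> c \<le> (\<Sum>i<d. w i * (\<Sum>k<d. \<bar>f i (v k)\<bar>))"
  then show thesis by (rule that)
qed

text \<open>Transposition turns projections onto \<open>E\<close> into resolutions. The operator \<open>I - P\<close> vanishes on the
  common kernel \<open>E\<close> of the functionals, so each of its rows is a combination of them, that is, of
  the form \<open>b \<mapsto> f b (v a)\<close>; and since \<open>P\<close> maps into \<open>E\<close>, these functionals take the same values
  at \<open>x\<close> and at \<open>(I - P) x\<close>, which says that \<open>v\<close> is a resolution.\<close>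

lemma projection_onto_annihilator:
  assumes f: "\<And>a. linear (f a)"
    and z: "\<And>k. k < n \<Longrightarrow> z k \<in> coord_space D"
    and fz: "\<And>k l. k < n \<Longrightarrow> l < n \<Longrightarrow>
      (\<Sum>a<D. f a (unit_vec k) * apply_bcontfun (z l) a) = (if k = l then 1 else 0)"
    and E: "E = {x \<in> coord_space D. \<forall>k<n. (\<Sum>a<D. f a (unit_vec k) * apply_bcontfun x a) = 0}"
    and P: "projection_onto E P"
  obtains v where "v \<in> resolutions n D f"
    "\<And>a b. a < D \<Longrightarrow> b < D \<Longrightarrow> apply_bcontfun (unit_vec b - P (unit_vec b)) a = f b (v a)"
proof
  let ?V = "coord_space n"
  have linP: "linear P" using P by (simp add: projection_onto_def bounded_linear.linear)
  have f_expand: "f a u = (\<Sum>k<n. apply_bcontfun u k * f a (unit_vec k))" if "u \<in> ?V" for a u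
    using linear_coord_expansion[OF f that] by simp
  define q where "q l = z l - P (z l)" for l
  define v where "v a = coord_vec n (\<lambda>l. apply_bcontfun (q l) a)" for a
  have vV: "v a \<in> ?V" for a by (simp add: v_def coord_vec_in)
  have fq: "(\<Sum>a<D. f a (unit_vec k) * apply_bcontfun (q l) a) = (if k = l then 1 else 0)"
    if "k < n" "l < n" for k l
  proof -
    have "(\<Sum>a<D. f a (unit_vec k) * apply_bcontfun (P (z l)) a) = 0"
      using projection_in[OF P, of "z l"] that unfolding E by blast
    then show ?thesis using fz[OF that] by (simp add: q_def right_diff_distrib sum_subtractf)
  qed
  show "v \<in> resolutions n D f"
    unfolding resolutions_def
  proof (intro CollectI conjI allI ballI impI vV)
    fix u assume u: "u \<in> ?V"
    show "(\<Sum>a<D. f a u *\<^sub>R v a) = u"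
    proof (rule bcontfun_eqI)
      fix l
      show "apply_bcontfun (\<Sum>a<D. f a u *\<^sub>R v a) l = apply_bcontfun u l"
      proof (cases "l < n")
        case True
        have "apply_bcontfun (\<Sum>a<D. f a u *\<^sub>R v a) l
            = (\<Sum>a<D. (\<Sum>k<n. apply_bcontfun u k * f a (unit_vec k)) * apply_bcontfun (q l) a)"
          using True by (simp add: apply_sum v_def coord_vec_apply f_expand[OF u])
        also have "\<dots> = (\<Sum>k<n. apply_bcontfun u k * (\<Sum>a<D. f a (unit_vec k) * apply_bcontfun (q l) a))"
          unfolding sum_distrib_right sum_distrib_left by (subst sum.swap) (simp add: mult.assoc)
        also have "\<dots> = (\<Sum>k<n. if k = l then apply_bcontfun u k else 0)"
          by (intro sum.cong refl) (simp add: fq True)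
        also have "\<dots> = apply_bcontfun u l" using True by simp
        finally show ?thesis .
      next
        case False
        then show ?thesis by (simp add: apply_sum v_def coord_vec_apply coord_space_apply[OF u])
      qed
    qed
  qed
  fix a b assume b: "b < D"
  define y where "y = unit_vec b - (\<Sum>k<n. f b (unit_vec k) *\<^sub>R z k)"
  have "y \<in> E"
    unfolding E
  proof (intro CollectI conjI allI impI)
    show "y \<in> coord_space D"
      unfolding y_def using z b
      by (intro subspace_diff subspace_sum subspace_scale subspace_coord_space unit_vec_in) auto
    fix k assume k: "k < n"
    have "(\<Sum>a<D. f a (unit_vec k) * apply_bcontfun (unit_vec b) a) = f b (unit_vec k)"
      using b by (simp add: unit_vec_apply if_distrib[of "\<lambda>t. _ * t"] cong: if_cong)
    moreover have "(\<Sum>a<D. f a (unit_vec k) * apply_bcontfun (\<Sum>l<n. f b (unit_vec l) *\<^sub>R z l) a)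
        = (\<Sum>l<n. f b (unit_vec l) * (\<Sum>a<D. f a (unit_vec k) * apply_bcontfun (z l) a))"
      unfolding apply_sum sum_distrib_left by (subst sum.swap) (simp add: mult.left_commute)
    moreover have "\<dots> = (\<Sum>l<n. if k = l then f b (unit_vec l) else 0)"
      by (intro sum.cong refl) (simp add: fz k)
    ultimately show "(\<Sum>a<D. f a (unit_vec k) * apply_bcontfun y a) = 0"
      using k by (simp add: y_def right_diff_distrib sum_subtractf)
  qed
  then have "P y = y" by (rule projection_fixes[OF P])
  then have "unit_vec b - P (unit_vec b) = (\<Sum>k<n. f b (unit_vec k) *\<^sub>R q k)"
    by (simp add: y_def q_def linear_diff[OF linP] linear_sum[OF linP] linear_scale[OF linP]
        scaleR_diff_right sum_subtractf algebra_simps)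
  then show "apply_bcontfun (unit_vec b - P (unit_vec b)) a = f b (v a)"
    by (subst f_expand[OF vV]) (simp add: apply_sum v_def coord_vec_apply mult.commute)
qed

text \<open>The row sum is a coordinate of the image of the vector of signs of the row.\<close>

lemma sum_abs_row_le_onorm:
  assumes P: "bounded_linear P"
  shows "(\<Sum>b<D. \<bar>apply_bcontfun (P (unit_vec b) :: linf) a\<bar>) \<le> onorm P"
proof -
  define s where "s = coord_vec D (\<lambda>b. sgn (apply_bcontfun (P (unit_vec b)) a))"
  have linP: "linear P" using P by (rule bounded_linear.linear)
  have "(\<Sum>b<D. \<bar>apply_bcontfun (P (unit_vec b)) a\<bar>) = apply_bcontfun (P s) a"
    by (simp add: s_def coord_vec_eq_sum linear_sum[OF linP] linear_scale[OF linP] apply_sum abs_sgn mult.commute)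
  also have "\<dots> \<le> norm (P s)" using abs_apply_le_norm[of "P s" a] by linarith
  also have "\<dots> \<le> onorm P * norm s" by (rule onorm[OF P])
  also have "\<dots> \<le> onorm P * 1"
    by (intro mult_left_mono onorm_pos_le P norm_linf_le) (simp add: s_def coord_vec_apply abs_sgn_eq)
  finally show ?thesis by simp
qed

text \<open>Compared to one plus the row sum, subtracting the row from the unit vector loses at most twice the
  diagonal entry. As this entry is repeated \<open>q\<close> times in the row, it is at most the \<open>q\<close>-th part of the row sum.\<close>

lemma row_sum_complement_ge:
  fixes h :: "nat \<Rightarrow> real"
  assumes a: "a < D" and fibre: "q \<le> card {b. b < D \<and> \<iota> b = \<iota> a}"
    and const: "\<And>b. b < D \<Longrightarrow> \<iota> b = \<iota> a \<Longrightarrow> h b = h a" and q: "1 \<le> q"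
  shows "1 + (1 - 2 / real q) * (\<Sum>b<D. \<bar>h b\<bar>) \<le> (\<Sum>b<D. \<bar>(if b = a then 1 else 0) - h b\<bar>)"
proof -
  let ?F = "{b. b < D \<and> \<iota> b = \<iota> a}"
  have "real q * \<bar>h a\<bar> \<le> real (card ?F) * \<bar>h a\<bar>" using fibre by (intro mult_right_mono) auto
  also have "\<dots> = (\<Sum>b\<in>?F. \<bar>h b\<bar>)" by (simp add: const)
  also have "\<dots> \<le> (\<Sum>b<D. \<bar>h b\<bar>)" by (rule sum_mono2) auto
  finally have "2 * \<bar>h a\<bar> \<le> (2 / real q) * (\<Sum>b<D. \<bar>h b\<bar>)" using q by (simp add: field_simps)
  moreover have "(\<Sum>b<D. \<bar>h b\<bar> + (if b = a then 1 - 2 * \<bar>h a\<bar> else 0))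
      \<le> (\<Sum>b<D. \<bar>(if b = a then 1 else 0) - h b\<bar>)"
    by (intro sum_mono) auto
  then have "(\<Sum>b<D. \<bar>h b\<bar>) + 1 - 2 * \<bar>h a\<bar> \<le> (\<Sum>b<D. \<bar>(if b = a then 1 else 0) - h b\<bar>)"
    using a by (simp add: sum.distrib)
  ultimately show ?thesis by (simp add: left_diff_distrib)
qed

lemma fibre_sums_resolution:
  assumes v: "v \<in> resolutions n D (\<lambda>a. f (\<iota> a))" and \<iota>: "\<And>a. a < D \<Longrightarrow> \<iota> a < d"
  shows "(\<lambda>i. \<Sum>a\<in>{a\<in>{..<D}. \<iota> a = i}. v a) \<in> resolutions n d f"
  unfolding resolutions_def
proof (intro CollectI conjI allI ballI impI)
  show "(\<Sum>a\<in>{a\<in>{..<D}. \<iota> a = i}. v a) \<in> coord_space n" for i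
    using v by (intro subspace_sum subspace_coord_space) (auto simp: resolutions_def)
  fix u assume u: "u \<in> coord_space n"
  have "(\<Sum>i<d. f i u *\<^sub>R (\<Sum>a\<in>{a\<in>{..<D}. \<iota> a = i}. v a))
      = (\<Sum>i<d. \<Sum>a\<in>{a\<in>{..<D}. \<iota> a = i}. f (\<iota> a) u *\<^sub>R v a)"
    by (intro sum.cong refl) (simp add: scaleR_sum_right)
  also have "\<dots> = (\<Sum>a<D. f (\<iota> a) u *\<^sub>R v a)"
    by (rule sum.group) (use \<iota> in auto)
  also have "\<dots> = u" using v u by (simp add: resolutions_def)
  finally show "(\<Sum>i<d. f i u *\<^sub>R (\<Sum>a\<in>{a\<in>{..<D}. \<iota> a = i}. v a)) = u" .
qed

lemma sum_over_fibres:
  fixes h :: "nat \<Rightarrow> real" and D :: nat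
  assumes "\<And>a. a < D \<Longrightarrow> \<iota> a < d" "\<And>i. i < d \<Longrightarrow> card {a. a < D \<and> \<iota> a = i} = m i"
  shows "(\<Sum>a<D. h (\<iota> a)) = (\<Sum>i<d. real (m i) * h i)"
proof -
  have "(\<Sum>a<D. h (\<iota> a)) = (\<Sum>i<d. \<Sum>a\<in>{a\<in>{..<D}. \<iota> a = i}. h (\<iota> a))"
    by (rule sum.group[symmetric]) (use assms(1) in auto)
  also have "\<dots> = (\<Sum>i<d. real (m i) * h i)"
    by (intro sum.cong refl) (simp add: assms(2))
  finally show ?thesis .
qed

text \<open>The subspace \<open>E\<close> is the annihilator of the functionals \<open>f i\<close>, each repeated about \<open>D w\<^sub>i\<close> times.
  Repetition makes the weights almost equal, so that the average of the row sums is the sum of all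
  absolute entries divided by \<open>D\<close>, and this does not change under transposition. So
  the lower bound \<open>c\<close>, known for resolutions, passes to the matrix of \<open>I - P\<close> for every projection
  \<open>P\<close> onto \<open>E\<close>. Subtracting this matrix from the identity adds \<open>1\<close> to the row sums, up to a loss by
  the factor \<open>1 - 2 / q\<close>, because repeated indices have equal columns.\<close>

lemma large_projections_codim:
  assumes f: "\<And>i. linear (f i)" and ne: "resolutions n d f \<noteq> {}"
    and w: "\<And>i. i < d \<Longrightarrow> 0 \<le> w i" "(\<Sum>i<d. w i) = 1"
      "\<And>v. v \<in> resolutions n d f \<Longrightarrow> c \<le> (\<Sum>i<d. w i * (\<Sum>k<d. \<bar>f i (v k)\<bar>))"
    and q: "2 \<le> q" and D: "d * q \<le> D" "0 < D"
  obtains E where "subspace E" "E \<subseteq> coord_space D" "dim E = D - n"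
    "\<And>P. projection_onto E P \<Longrightarrow> 1 + (1 - 2 / real q) * (1 - real d * real q / real D) * c \<le> onorm P"
proof -
  obtain m where m: "(\<Sum>i<d. m i) = D" "\<And>i. i < d \<Longrightarrow> q \<le> m i"
    "\<And>i. i < d \<Longrightarrow> (real D - real d * real q) * w i \<le> real (m i)"
    using integer_multiplicities[OF w(1,2) _ D(1)] q by auto
  obtain \<iota> where \<iota>: "\<And>a. a < D \<Longrightarrow> \<iota> a < d" "\<And>i. i < d \<Longrightarrow> card {a. a < D \<and> \<iota> a = i} = m i"
    using map_with_fibre_sizes[where d = d and m = m] m(1) by auto
  note fibre_sum = sum_over_fibres[OF \<iota>]
  let ?f = "\<lambda>a. f (\<iota> a)"
  obtain v0 where v0: "v0 \<in> resolutions n d f" using ne by blast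
  \<comment> \<open>A resolution for the original indices, spread evenly over the copies of each index.\<close>
  define z where "z l = coord_vec D (\<lambda>a. apply_bcontfun (v0 (\<iota> a)) l / real (m (\<iota> a)))" for l
  define E where "E = {x \<in> coord_space D. \<forall>k<n. (\<Sum>a<D. ?f a (unit_vec k) * apply_bcontfun x a) = 0}"
  have z: "z l \<in> coord_space D" for l by (simp add: z_def coord_vec_in)
  have fz: "(\<Sum>a<D. ?f a (unit_vec k) * apply_bcontfun (z l) a) = (if k = l then 1 else 0)"
    if k: "k < n" for k l
  proof -
    have "(\<Sum>a<D. ?f a (unit_vec k) * apply_bcontfun (z l) a)
        = (\<Sum>i<d. real (m i) * (f i (unit_vec k) * (apply_bcontfun (v0 i) l / real (m i))))"
      using fibre_sum[of "\<lambda>i. f i (unit_vec k) * (apply_bcontfun (v0 i) l / real (m i))"]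
      by (simp add: z_def coord_vec_apply)
    also have "\<dots> = (\<Sum>i<d. f i (unit_vec k) * apply_bcontfun (v0 i) l)"
    proof (intro sum.cong refl)
      fix i assume "i \<in> {..<d}"
      then have "0 < m i" using m(2)[of i] q by simp
      then show "real (m i) * (f i (unit_vec k) * (apply_bcontfun (v0 i) l / real (m i)))
          = f i (unit_vec k) * apply_bcontfun (v0 i) l" by simp
    qed
    also have "\<dots> = apply_bcontfun (\<Sum>i<d. f i (unit_vec k) *\<^sub>R v0 i) l" by (simp add: apply_sum)
    also have "(\<Sum>i<d. f i (unit_vec k) *\<^sub>R v0 i) = unit_vec k"
      using v0 unit_vec_in[OF k] by (simp add: resolutions_def)
    finally show ?thesis by (simp add: unit_vec_apply eq_commute)
  qed
  have lower: "1 + (1 - 2 / real q) * (1 - real d * real q / real D) * c \<le> onorm P"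
    if P: "projection_onto E P" for P
  proof -
    have blP: "bounded_linear P" using P by (simp add: projection_onto_def)
    obtain v where v: "v \<in> resolutions n D ?f"
      "\<And>a b. a < D \<Longrightarrow> b < D \<Longrightarrow> apply_bcontfun (unit_vec b - P (unit_vec b)) a = ?f b (v a)"
      using projection_onto_annihilator[of ?f n z D E P, OF f z fz E_def P] by blast
    have row: "1 + (1 - 2 / real q) * (\<Sum>b<D. \<bar>?f b (v a)\<bar>) \<le> onorm P" if a: "a < D" for a
    proof -
      have "1 + (1 - 2 / real q) * (\<Sum>b<D. \<bar>?f b (v a)\<bar>)
          \<le> (\<Sum>b<D. \<bar>(if b = a then 1 else 0) - ?f b (v a)\<bar>)"
        by (rule row_sum_complement_ge[of _ _ _ \<iota>]) (use a \<iota> m(2) q in auto)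
      also have "\<dots> = (\<Sum>b<D. \<bar>apply_bcontfun (P (unit_vec b)) a\<bar>)"
        by (intro sum.cong refl) (use v(2)[OF a, symmetric] in \<open>auto simp: unit_vec_apply\<close>)
      also have "\<dots> \<le> onorm P" by (rule sum_abs_row_le_onorm[OF blP])
      finally show ?thesis .
    qed
    \<comment> \<open>Adding up the copies turns \<open>v\<close> into a resolution for the original indices.\<close>
    define u where "u i = (\<Sum>a\<in>{a\<in>{..<D}. \<iota> a = i}. v a)" for i
    have u: "u \<in> resolutions n d f"
      unfolding u_def by (rule fibre_sums_resolution[OF v(1) \<iota>(1)])
    have col: "(\<Sum>k<d. \<bar>f i (u k)\<bar>) \<le> (\<Sum>a<D. \<bar>f i (v a)\<bar>)" for i
    proof -
      have "(\<Sum>k<d. \<bar>f i (u k)\<bar>) \<le> (\<Sum>k<d. \<Sum>a\<in>{a\<in>{..<D}. \<iota> a = k}. \<bar>f i (v a)\<bar>)"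
        by (intro sum_mono) (simp add: u_def linear_sum[OF f] sum_abs)
      also have "\<dots> = (\<Sum>a<D. \<bar>f i (v a)\<bar>)" by (rule sum.group) (use \<iota>(1) in auto)
      finally show ?thesis .
    qed
    define M where "M = real D - real d * real q"
    have M: "0 \<le> M" using D unfolding M_def by (simp flip: of_nat_mult)
    have "M * c \<le> M * (\<Sum>i<d. w i * (\<Sum>k<d. \<bar>f i (u k)\<bar>))" using w(3)[OF u] M by (rule mult_left_mono)
    also have "\<dots> = (\<Sum>i<d. (M * w i) * (\<Sum>k<d. \<bar>f i (u k)\<bar>))" by (simp add: sum_distrib_left mult.assoc)
    also have "\<dots> \<le> (\<Sum>i<d. real (m i) * (\<Sum>k<d. \<bar>f i (u k)\<bar>))"
      using m(3) by (intro sum_mono mult_right_mono) (auto simp: M_def sum_nonneg)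
    also have "\<dots> \<le> (\<Sum>i<d. real (m i) * (\<Sum>a<D. \<bar>f i (v a)\<bar>))"
      by (intro sum_mono mult_left_mono col) simp
    also have "\<dots> = (\<Sum>b<D. \<Sum>a<D. \<bar>?f b (v a)\<bar>)" by (rule fibre_sum[symmetric])
    \<comment> \<open>Here the roles of rows and columns are exchanged.\<close>
    also have "\<dots> = (\<Sum>a<D. \<Sum>b<D. \<bar>?f b (v a)\<bar>)" by (rule sum.swap)
    finally have total: "M * c \<le> (\<Sum>a<D. \<Sum>b<D. \<bar>?f b (v a)\<bar>)" .
    have "real D + (1 - 2 / real q) * (M * c) \<le> real D + (1 - 2 / real q) * (\<Sum>a<D. \<Sum>b<D. \<bar>?f b (v a)\<bar>)"
      using total q by (intro add_left_mono mult_left_mono) auto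
    also have "\<dots> = (\<Sum>a<D. 1 + (1 - 2 / real q) * (\<Sum>b<D. \<bar>?f b (v a)\<bar>))"
      by (simp add: sum.distrib sum_distrib_left)
    also have "\<dots> \<le> (\<Sum>a<D. onorm P)" by (intro sum_mono row) simp
    also have "\<dots> = real D * onorm P" by simp
    finally have "(real D + (1 - 2 / real q) * (M * c)) / real D \<le> onorm P"
      using D(2) by (simp add: divide_le_eq mult.commute)
    moreover have "M = real D * (1 - real d * real q / real D)" using D(2) by (simp add: M_def field_simps)
    then have "(real D + (1 - 2 / real q) * (M * c)) / real D
        = 1 + (1 - 2 / real q) * (1 - real d * real q / real D) * c"
      using D(2) by (simp add: add_divide_distrib)
    ultimately show ?thesis by simp
  qed
  show thesis
  proof (rule that)
    show "subspace E" "dim E = D - n"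
      using dim_of_functionals[of n z D "\<lambda>k a. ?f a (unit_vec k)" E, OF z fz E_def] by auto
    show "E \<subseteq> coord_space D" by (auto simp: E_def)
  qed (rule lower)
qed

section \<open>The limit\<close>

lemma sup_proj_const_le:
  assumes "n \<le> d"
  shows "sup_proj_const (d - n) d \<le> 1 + max_proj_const n"
  unfolding sup_proj_const_def
proof (rule cSup_least)
  have "coord_space (d - n) \<subseteq> coord_space d" by (auto simp: coord_space_def)
  then show "{proj_const E norm |E. subspace E \<and> E \<subseteq> coord_space d \<and> dim E = d - n} \<noteq> {}"
    using subspace_coord_space[of "d - n"] dim_coord_space[of "d - n"] by blast
qed (use assms proj_const_le_codim in blast)

lemma sup_proj_const_ge:
  assumes nd: "n \<le> d" and E: "subspace E" "E \<subseteq> coord_space d" "dim E = d - n"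
    and b: "\<And>P. projection_onto E P \<Longrightarrow> b \<le> onorm P"
  shows "b \<le> sup_proj_const (d - n) d"
proof -
  obtain P0 where P0: "projection_onto E P0" using small_projection_codim[OF E nd, of 1] by auto
  have "b \<le> proj_const E norm"
  proof (rule ccontr)
    assume "\<not> ?thesis"
    then obtain P where "projection_onto ((\<lambda>x. x) ` E) P" "onorm P < b"
      using proj_const_less[OF E(1) norm_on_norm isometric_embedding_inclusion, of P0 b] P0 by auto
    with b[of P] show False by simp
  qed
  also have "\<dots> \<le> sup_proj_const (d - n) d"
    unfolding sup_proj_const_def
  proof (rule cSup_upper)
    show "bdd_above {proj_const E norm |E. subspace E \<and> E \<subseteq> coord_space d \<and> dim E = d - n}"
      by (rule bdd_aboveI[of _ "1 + max_proj_const n"]) (use nd proj_const_le_codim in blast)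
  qed (use E in blast)
  finally show ?thesis .
qed

theorem corollary1p3:
  fixes n :: nat
  assumes "n \<ge> 1"
  shows "(\<lambda>d. sup_proj_const (d - n) d) \<longlonglongrightarrow> 1 + max_proj_const n"
proof (rule order_tendstoI)
  fix y :: real assume "1 + max_proj_const n < y"
  moreover have "\<forall>\<^sub>F d in sequentially. sup_proj_const (d - n) d \<le> 1 + max_proj_const n"
    by (rule eventually_mono[OF eventually_ge_at_top[of n] sup_proj_const_le])
  ultimately show "\<forall>\<^sub>F d in sequentially. sup_proj_const (d - n) d < y"
    by (auto elim: eventually_mono)
next
  fix y :: real assume y: "y < 1 + max_proj_const n"
  obtain N where N: "norm_on (coord_space n) N" "proj_const (coord_space n) N = max_proj_const n"
    using max_proj_const_attained[of n] by metis
  \<comment> \<open>The error terms in \<open>1 / q\<close> are made small first; then \<open>d\<close> is fixed and \<open>D\<close> tends to infinity.\<close>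
  have "(\<lambda>q. 1 + (1 - 2 / real q) * ((1 - 1 / real q) * max_proj_const n))
      \<longlonglongrightarrow> 1 + (1 - 0) * ((1 - 0) * max_proj_const n)"
    by (intro tendsto_intros lim_const_over_n)
  then have "\<forall>\<^sub>F q in sequentially. y < 1 + (1 - 2 / real q) * ((1 - 1 / real q) * max_proj_const n)"
    using y by (intro order_tendstoD(1)) auto
  then obtain q where q: "2 \<le> q" "y < 1 + (1 - 2 / real q) * ((1 - 1 / real q) * max_proj_const n)"
    using eventually_happens'[OF sequentially_bot eventually_conj[OF eventually_ge_at_top[of 2]]] by blast
  define c where "c = (1 - 1 / real q) * proj_const (coord_space n) N"
  have pos: "0 < 1 / real q" "1 / real q < 1" using q(1) by auto
  obtain d and f :: "nat \<Rightarrow> linf \<Rightarrow> real"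
     where f: "\<And>i. linear (f i)" "resolutions n d f \<noteq> {}"
    and fc: "\<And>v. v \<in> resolutions n d f \<Longrightarrow> \<exists>i<d. c \<le> (\<Sum>k<d. \<bar>f i (v k)\<bar>)"
  proof (rule resolutions_of_norm[OF N(1) pos])
    fix d and f :: "nat \<Rightarrow> linf \<Rightarrow> real"
    assume "\<And>i. linear (f i)" "resolutions n d f \<noteq> {}"
      "\<And>v. v \<in> resolutions n d f \<Longrightarrow>
        \<exists>i<d. (1 - 1 / real q) * proj_const (coord_space n) N \<le> (\<Sum>k<d. \<bar>f i (v k)\<bar>)"
    then show thesis by (rule that[of f d, unfolded c_def])
  qed
  obtain w where w: "\<And>i. i < d \<Longrightarrow> 0 \<le> w i" "(\<Sum>i<d. w i) = 1"
    "\<And>v. v \<in> resolutions n d f \<Longrightarrow> c \<le> (\<Sum>i<d. w i * (\<Sum>k<d. \<bar>f i (v k)\<bar>))"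
  proof (rule resolution_weights[OF f fc])
    fix w assume "\<And>i. i < d \<Longrightarrow> 0 \<le> w i" "(\<Sum>i<d. w i) = 1"
      "\<And>v. v \<in> resolutions n d f \<Longrightarrow> c \<le> (\<Sum>i<d. w i * (\<Sum>k<d. \<bar>f i (v k)\<bar>))"
    then show thesis by (rule that)
  qed
  have "(\<lambda>D. 1 + (1 - 2 / real q) * (1 - real d * real q / real D) * c)
      \<longlonglongrightarrow> 1 + (1 - 2 / real q) * (1 - 0) * c"
    by (intro tendsto_intros lim_const_over_n)
  then have "\<forall>\<^sub>F D in sequentially. y < 1 + (1 - 2 / real q) * (1 - real d * real q / real D) * c"
    using q(2) by (intro order_tendstoD(1)) (auto simp: c_def N(2))
  then show "\<forall>\<^sub>F D in sequentially. y < sup_proj_const (D - n) D"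
    using eventually_ge_at_top[of n] eventually_ge_at_top[of "d * q"] eventually_gt_at_top[of 0]
  proof eventually_elim
    case (elim D)
    obtain E where E: "subspace E" "E \<subseteq> coord_space D" "dim E = D - n"
      "\<And>P. projection_onto E P \<Longrightarrow> 1 + (1 - 2 / real q) * (1 - real d * real q / real D) * c \<le> onorm P"
      using large_projections_codim[OF f w q(1) elim(3,4)] by blast
    show ?case using sup_proj_const_ge[OF elim(2) E] elim(1) by linarith
  qed
qed

end
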